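(* For every integer $k\geq 2$, there exists an infinite strongly rotarily transitive connected graph with countably many vertices and diameter exactly $k$.
   Context: A graph is a pair $\mathcal{G}=(V,E)$ where $V$ is a set (of vertices) and $E$ (the edges) is a set of subsets of $V$ having exactly two elements. It is infinite if $V$ is infinite. A path of length $n\ge 0$ is a finite sequence of vertices $(v_0,\dots,v_n)$ such that $\{v_i,v_{i+1}\}\in E$ for all $i<n$; it connects $v_0$ and $v_n$. A graph is connected if any two vertices are connected by a path. The diameter of a connected graph is the smallest $k\in\mathbb{N}\cup\{\infty\}$ such that any two vertices are connected by a path of length at most $k$. An automorphism of $\mathcal{G}$ is a bijection $\varphi:V\to V$ such that for all $u,v\in V$, $\{u,v\}\in E \iff \{\varphi(u),\varphi(v)\}\in E$; these form the group $\mathrm{Aut}(\mathcal{G})$. A graph $\mathcal{G}$ is strongly rotarily transitive if the natural action of $\mathrm{Aut}(\mathcal{G})$ on $V$ is transitive and every element of $\mathrm{Aut}(\mathcal{G})$ (including the identity) fixes at least one vertex. *)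

theory Defs
  imports "HOL-Algebra.Group_Action" "HOL-Library.Countable_Set" "HOL-Library.Extended_Nat"
begin

definition is_graph :: "'a set \<Rightarrow> 'a set set \<Rightarrow> bool" where
  "is_graph V E \<longleftrightarrow> (\<forall>e\<in>E. e \<subseteq> V \<and> card e = 2)"

text \<open>A path of length \<open>n\<close> is given by the nonempty list of its \<open>n + 1\<close> vertices; vertices may repeat.\<close>

definition graph_path :: "'a set \<Rightarrow> 'a set set \<Rightarrow> 'a list \<Rightarrow> bool" where
  "graph_path V E vs \<longleftrightarrow>
     vs \<noteq> [] \<and> set vs \<subseteq> V \<and> (\<forall>i. Suc i < length vs \<longrightarrow> {vs ! i, vs ! Suc i} \<in> E)"

definition path_length :: "'a list \<Rightarrow> nat" where
  "path_length vs = length vs - 1"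

definition path_connects :: "'a set \<Rightarrow> 'a set set \<Rightarrow> 'a list \<Rightarrow> 'a \<Rightarrow> 'a \<Rightarrow> bool" where
  "path_connects V E vs u v \<longleftrightarrow> graph_path V E vs \<and> hd vs = u \<and> last vs = v"

definition graph_connected :: "'a set \<Rightarrow> 'a set set \<Rightarrow> bool" where
  "graph_connected V E \<longleftrightarrow> (\<forall>u\<in>V. \<forall>v\<in>V. \<exists>vs. path_connects V E vs u v)"

text \<open>Only meaningful for connected graphs, where \<open>\<infinity>\<close> always satisfies the condition.\<close>

definition graph_diameter :: "'a set \<Rightarrow> 'a set set \<Rightarrow> enat" where
  "graph_diameter V E =
     (LEAST k. \<forall>u\<in>V. \<forall>v\<in>V. \<exists>vs. path_connects V E vs u v \<and> enat (path_length vs) \<le> k)"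

text \<open>As in \<^term>\<open>BijGroup V\<close>, the elements are bijections of \<open>V\<close> that are \<^const>\<open>undefined\<close>
  outside \<open>V\<close>, so distinct elements of the group differ on \<open>V\<close>.\<close>

definition aut_group :: "'a set \<Rightarrow> 'a set set \<Rightarrow> ('a \<Rightarrow> 'a) monoid" where
  "aut_group V E =
     (BijGroup V)\<lparr>carrier := {\<phi> \<in> Bij V. \<forall>u\<in>V. \<forall>v\<in>V. {u, v} \<in> E \<longleftrightarrow> {\<phi> u, \<phi> v} \<in> E}\<rparr>"

lemma subgroup_aut_group: "subgroup (carrier (aut_group V E)) (BijGroup V)"
proof (rule group.subgroupI [OF group_BijGroup])
  show "carrier (aut_group V E) \<subseteq> carrier (BijGroup V)"
    by (auto simp: aut_group_def BijGroup_def)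
  show "carrier (aut_group V E) \<noteq> {}"
    using id_Bij [of V] by (auto simp: aut_group_def intro!: exI [of _ "\<lambda>x\<in>V. x"])
next
  fix f assume "f \<in> carrier (aut_group V E)"
  then have f: "f \<in> Bij V" and e: "\<And>u v. u \<in> V \<Longrightarrow> v \<in> V \<Longrightarrow> {u, v} \<in> E \<longleftrightarrow> {f u, f v} \<in> E"
    by (auto simp: aut_group_def)
  have fV: "f ` V = V"
    using f by (auto simp: Bij_def bij_betw_def)
  have "{u, v} \<in> E \<longleftrightarrow> {inv_into V f u, inv_into V f v} \<in> E" if "u \<in> V" "v \<in> V" for u v
    using e [of "inv_into V f u" "inv_into V f v"] that fV
    by (simp add: inv_into_into f_inv_into_f)
  then show "inv\<^bsub>BijGroup V\<^esub> f \<in> carrier (aut_group V E)"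
    using f by (simp add: inv_BijGroup aut_group_def restrict_inv_into_Bij)
next
  fix f g assume "f \<in> carrier (aut_group V E)" "g \<in> carrier (aut_group V E)"
  then show "f \<otimes>\<^bsub>BijGroup V\<^esub> g \<in> carrier (aut_group V E)"
    using Bij_imp_funcset [of g V]
    by (auto simp: aut_group_def BijGroup_def compose_Bij compose_eq Pi_iff)
qed

lemma group_action_aut_group: "group_action (aut_group V E) V (\<lambda>\<phi>. \<phi>)"
proof -
  have "aut_group V E = (BijGroup V)\<lparr>carrier := carrier (aut_group V E)\<rparr>"
    by (simp add: aut_group_def)
  then have "group (aut_group V E)"
    using group.subgroup_imp_group [OF group_BijGroup subgroup_aut_group] by metis
  moreover have "(\<lambda>\<phi>. \<phi>) \<in> hom (aut_group V E) (BijGroup V)"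
    by (auto simp: hom_def aut_group_def BijGroup_def)
  ultimately show ?thesis
    by (simp add: group_action_def group_hom_def group_hom_axioms_def group_BijGroup)
qed

definition strongly_rotarily_transitive :: "'a set \<Rightarrow> 'a set set \<Rightarrow> bool" where
  "strongly_rotarily_transitive V E \<longleftrightarrow>
     transitive_action (aut_group V E) V (\<lambda>\<phi>. \<phi>) \<and>
     (\<forall>\<phi>\<in>carrier (aut_group V E). \<exists>v\<in>V. \<phi> v = v)"

end

theory Submission
  imports Defs "HOL-Analysis.Determinants"
begin

text \<open>
  Let \<open>K\<close> be a countable subfield of the reals that is closed under square roots and contains
  \<open>cos (\<pi> / 2k)\<close>. The vertices are the points of the projective plane over \<open>K\<close>, and two points are
  adjacent when they enclose the angle \<open>\<theta> = \<pi> / 2k\<close>; for \<open>k = 2\<close> the angle \<open>\<pi> / 2\<close> is used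
  instead. The orthogonal group acts transitively by automorphisms, and since all angles between
  points are at most \<open>\<pi> / 2 = k\<theta>\<close>, the diameter is \<open>k\<close>.

  For \<open>k \<ge> 3\<close>, if \<open>w\<close> is the only common neighbour of \<open>u \<noteq> v\<close>, then it is invariant under the
  reflection in the plane spanned by \<open>u\<close> and \<open>v\<close>, so \<open>u, w, v\<close> are consecutive points on a geodesic.
  Chaining \<open>k\<close> such steps characterises orthogonality in terms of the graph.
  Hence every automorphism preserves orthogonality. As in the fundamental theorem of projective
  geometry, such a map comes from an orthogonal matrix up to an endomorphism of \<open>K\<close>, which is the
  identity because \<open>K\<close> is Archimedean and its positive elements are squares. Finally, up to
  sign, an orthogonal \<open>3 \<times> 3\<close> matrix is a rotation, and it fixes its axis.
\<close>

subsection \<open>Vectors over an ordered field\<close>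

definition dot :: "'a::comm_ring_1 ^ 'n \<Rightarrow> 'a ^ 'n \<Rightarrow> 'a" where
  "dot u v = (\<Sum>i\<in>UNIV. u $ i * v $ i)"

definition parallel :: "'a::field ^ 'n \<Rightarrow> 'a ^ 'n \<Rightarrow> bool" where
  "parallel u v \<longleftrightarrow> (\<exists>t. t \<noteq> 0 \<and> v = t *s u)"

lemma dot_commute: "dot u v = dot v u"
  by (simp add: dot_def mult.commute)

lemma dot_simps [simp]:
  "dot (u + v) w = dot u w + dot v w" "dot w (u + v) = dot w u + dot w v"
  "dot (u - v) w = dot u w - dot v w" "dot w (u - v) = dot w u - dot w v"
  "dot (t *s u) w = t * dot u w" "dot w (t *s u) = t * dot w u"
  "dot (- u) w = - dot u w" "dot w (- u) = - dot w u"
  "dot 0 w = 0" "dot w 0 = 0"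
  by (simp_all add: dot_def algebra_simps sum.distrib sum_subtractf sum_distrib_left sum_negf)

lemma dot_axis [simp]: "dot v (axis i 1) = v $ i" "dot (axis i 1) v = v $ i"
  by (simp_all add: dot_def axis_def if_distrib if_distribR cong: if_cong)

lemma dot_self_nonneg [simp]: "0 \<le> dot u (u :: 'a::linordered_field ^ 'n)"
  by (simp add: dot_def sum_nonneg)

lemma dot_self_eq_0_iff [simp]: "dot u u = 0 \<longleftrightarrow> u = (0 :: 'a::linordered_field ^ 'n)"
  by (simp add: dot_def sum_nonneg_eq_0_iff vec_eq_iff)

lemma dot_self_pos_iff [simp]: "0 < dot u u \<longleftrightarrow> u \<noteq> (0 :: 'a::linordered_field ^ 'n)"
  by (simp add: less_le)

text \<open>The squared norm of \<open>dot v v *s u - dot u v *s v\<close> is expanded. This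
  division-free multiple of the component of \<open>u\<close> orthogonal to \<open>v\<close> avoids
  square roots, which an ordered field may lack.\<close>

lemma dot_Cauchy_Schwarz:
  fixes u v :: "'a::linordered_field ^ 'n"
  shows "(dot u v)\<^sup>2 \<le> dot u u * dot v v"
proof (cases "v = 0")
  case False
  have "0 \<le> dot (dot v v *s u - dot u v *s v) (dot v v *s u - dot u v *s v)"
    by (rule dot_self_nonneg)
  also have "\<dots> = dot v v * (dot u u * dot v v - (dot u v)\<^sup>2)"
    by (simp add: algebra_simps power2_eq_square dot_commute)
  finally show ?thesis
    using False by (metis diff_ge_0_iff_ge dot_self_pos_iff zero_le_mult_iff not_le)
qed simp

lemma parallel_refl [simp]: "parallel u u"
  unfolding parallel_def by (rule exI [of _ 1]) simp

lemma parallel_scale [simp]: "t \<noteq> 0 \<Longrightarrow> parallel u (t *s u)"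
  by (auto simp: parallel_def)

lemma parallel_sym: "parallel u v \<Longrightarrow> parallel v u"
proof -
  assume "parallel u v"
  then obtain t where "t \<noteq> 0" "v = t *s u" by (auto simp: parallel_def)
  then have "u = inverse t *s v" by (simp add: vector_smult_assoc)
  with \<open>t \<noteq> 0\<close> show ?thesis by (auto simp: parallel_def intro!: exI [of _ "inverse t"])
qed

lemma parallel_trans: "parallel u v \<Longrightarrow> parallel v w \<Longrightarrow> parallel u w"
  unfolding parallel_def using vector_smult_assoc no_zero_divisors by metis

lemma dot_eq_0_parallel_cong:
  assumes "parallel u u'" "parallel v v'"
  shows "dot u v = 0 \<longleftrightarrow> dot u' v' = 0"
  using assms by (auto simp: parallel_def)

lemma dot_orthogonal_matrix:
  fixes M :: "'a::comm_ring_1 ^ 'n ^ 'n"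
  assumes "orthogonal_matrix M"
  shows "dot (M *v u) (M *v v) = dot u v"
proof -
  have adj: "dot (M *v u) w = dot u (transpose M *v w)" for w
  proof -
    have "dot (M *v u) w = (\<Sum>i\<in>UNIV. \<Sum>j\<in>UNIV. M $ i $ j * u $ j * w $ i)"
      by (simp add: dot_def matrix_vector_mult_def sum_distrib_right)
    also have "\<dots> = (\<Sum>j\<in>UNIV. \<Sum>i\<in>UNIV. M $ i $ j * u $ j * w $ i)"
      by (rule sum.swap)
    also have "\<dots> = dot u (transpose M *v w)"
      by (simp add: dot_def matrix_vector_mult_def transpose_def sum_distrib_left mult_ac)
    finally show ?thesis .
  qed
  show ?thesis
    using assms by (simp add: adj matrix_vector_mul_assoc orthogonal_matrix_def)
qed

text \<open>A sign change, available because the dimension is odd, makes the determinant 1. Then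
  \<open>transpose R ** (R - mat 1)\<close> is the negated transpose of \<open>R - mat 1\<close>;
  negation reverses the determinant in dimension 3, so \<open>det (R - mat 1) = 0\<close>, and a
  nonzero kernel vector spans a fixed line.\<close>

lemma orthogonal_matrix_fixes_line:
  fixes M :: "'a::linordered_field ^ 3 ^ 3"
  assumes M: "orthogonal_matrix M"
  shows "\<exists>v. v \<noteq> 0 \<and> parallel v (M *v v)"
proof -
  obtain R where R: "orthogonal_matrix R" "det R = 1" "R = M \<or> R = - M"
  proof (cases "det M = 1")
    case False
    then have "det M = - 1"
      using det_orthogonal_matrix [OF M] by blast
    then have "det (- M) = 1"
      by (simp add: det_3)
    moreover have "orthogonal_matrix (- M)"
      using M by (simp add: orthogonal_matrix_def matrix_matrix_mult_def transpose_def vec_eq_iff)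
    ultimately show ?thesis
      using that by blast
  qed (use M that in blast)
  have "transpose R ** (R - mat 1) = - transpose (R - mat 1)"
  proof -
    have "transpose R ** (R - mat 1) = transpose R ** R - transpose R"
      using matrix_add_ldistrib [of "transpose R" "R - mat 1" "mat 1"] by (simp add: eq_diff_eq)
    then show ?thesis
      using R(1) by (simp add: orthogonal_matrix_def transpose_def mat_def vec_eq_iff)
  qed
  then have "det (R - mat 1) = det (- transpose (R - mat 1))"
    using R(2) by (metis det_mul det_transpose mult_1)
  also have "\<dots> = - det (transpose (R - mat 1))"
    by (simp add: det_3)
  finally have "det (R - mat 1) = 0"
    by simp
  then have "\<not> invertible (R - mat 1)"
    by (simp add: invertible_det_nz)
  then obtain v where v: "v \<noteq> 0" "(R - mat 1) *v v = 0"
    by (metis invertible_left_inverse matrix_left_invertible_ker)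
  then have "R *v v = v"
    by (simp add: matrix_vector_mult_diff_rdistrib)
  moreover have "(- M) *v v = (- 1) *s (M *v v)"
    by (simp add: matrix_vector_mult_def vec_eq_iff sum_negf)
  ultimately have "M *v v = v \<or> v = (- 1) *s (M *v v)"
    using R(3) by metis
  then have "parallel (M *v v) v"
    by (metis parallel_refl parallel_scale neg_equal_0_iff_equal one_neq_zero)
  then show ?thesis
    using v(1) parallel_sym by blast
qed

text \<open>In the equality case the vector expanded for Cauchy-Schwarz has norm zero and therefore
  vanishes.\<close>

lemma dot_square_eq_iff_parallel:
  fixes u v :: "'a::linordered_field ^ 'n"
  assumes "u \<noteq> 0" "v \<noteq> 0"
  shows "(dot u v)\<^sup>2 = dot u u * dot v v \<longleftrightarrow> parallel u v"
proof
  assume eq: "(dot u v)\<^sup>2 = dot u u * dot v v"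
  have "dot (dot v v *s u - dot u v *s v) (dot v v *s u - dot u v *s v)
      = dot v v * (dot u u * dot v v - (dot u v)\<^sup>2)"
    by (simp add: algebra_simps power2_eq_square dot_commute)
  with eq have "dot (dot v v *s u - dot u v *s v) (dot v v *s u - dot u v *s v) = 0"
    by (simp only: diff_self mult_zero_right)
  then have "dot v v *s u = dot u v *s v"
    by (simp only: dot_self_eq_0_iff right_minus_eq)
  then have "inverse (dot v v) *s (dot v v *s u) = inverse (dot v v) *s (dot u v *s v)"
    by simp
  then have u: "u = (inverse (dot v v) * dot u v) *s v"
    using assms(2) by (simp add: vector_smult_assoc)
  moreover have "inverse (dot v v) * dot u v \<noteq> 0"
    using eq assms by auto
  ultimately have "parallel v u"
    unfolding parallel_def by metis
  then show "parallel u v" by (rule parallel_sym)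
qed (auto simp: parallel_def power2_eq_square)

section \<open>The cross product and orthogonality in dimension 3\<close>

definition cross :: "'a::comm_ring_1 ^ 3 \<Rightarrow> 'a ^ 3 \<Rightarrow> 'a ^ 3" where
  "cross u v = vector [u $ 2 * v $ 3 - u $ 3 * v $ 2, u $ 3 * v $ 1 - u $ 1 * v $ 3,
                       u $ 1 * v $ 2 - u $ 2 * v $ 1]"

lemma dot_cross [simp]:
  "dot u (cross u v) = 0" "dot v (cross u v) = 0" "dot (cross u v) u = 0" "dot (cross u v) v = 0"
  by (simp_all add: dot_def cross_def sum_3 algebra_simps)

text \<open>Lagrange's identity, which turns the equality case of Cauchy-Schwarz into the vanishing
  of the cross product.\<close>

lemma dot_cross_cross: "dot (cross u v) (cross u v) = dot u u * dot v v - (dot u v)\<^sup>2"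
  by (simp add: dot_def cross_def sum_3 power2_eq_square algebra_simps)

lemma cross_cross: "cross u (cross v w) = dot u w *s v - dot u v *s w"
  by (simp add: dot_def cross_def sum_3 vec_eq_iff forall_3 algebra_simps)

lemma cross_neq_0:
  fixes u v :: "'a::linordered_field ^ 3"
  assumes "u \<noteq> 0" "v \<noteq> 0" "\<not> parallel u v"
  shows "cross u v \<noteq> 0"
  using assms dot_square_eq_iff_parallel dot_cross_cross
  by (metis diff_eq_eq add.left_neutral dot_self_eq_0_iff)

text \<open>The triple product \<open>cross w (cross u v)\<close> vanishes, so Lagrange's identity
  puts \<open>w\<close> and \<open>cross u v\<close> in the equality case of Cauchy-Schwarz.\<close>

lemma orthogonal_parallel_cross:
  fixes u v w :: "'a::linordered_field ^ 3"
  assumes "w \<noteq> 0" "cross u v \<noteq> 0" "dot w u = 0" "dot w v = 0"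
  shows "parallel w (cross u v)"
proof -
  have "dot (cross w (cross u v)) (cross w (cross u v)) = 0"
    using assms by (simp add: cross_cross)
  then have "(dot w (cross u v))\<^sup>2 = dot w w * dot (cross u v) (cross u v)"
    by (simp only: dot_cross_cross)
  with assms show ?thesis
    using dot_square_eq_iff_parallel by blast
qed

text \<open>A nonzero \<open>x\<close> would lie on the line of \<open>cross u v\<close>, as
  \<open>w\<close> does, and so be parallel to a vector orthogonal to it.\<close>

lemma orthogonal_to_orthogonal_triple:
  fixes u v w x :: "'a::linordered_field ^ 3"
  assumes "u \<noteq> 0" "v \<noteq> 0" "w \<noteq> 0" "dot u v = 0" "dot w u = 0" "dot w v = 0"
    and x: "dot x u = 0" "dot x v = 0" "dot x w = 0"
  shows "x = 0"
proof (rule ccontr)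
  assume "x \<noteq> 0"
  have "cross u v \<noteq> 0"
    using assms by (metis dot_cross_cross dot_self_eq_0_iff diff_zero mult_eq_0_iff zero_power2)
  then have "parallel x (cross u v)" "parallel w (cross u v)"
    using orthogonal_parallel_cross assms \<open>x \<noteq> 0\<close> by blast+
  then have "parallel x w"
    using parallel_sym parallel_trans by blast
  then have "dot x x = 0"
    using x(3) dot_eq_0_parallel_cong [OF parallel_refl] by blast
  with \<open>x \<noteq> 0\<close> show False by simp
qed

lemma unit_multiple_exists:
  fixes v :: "'a::linordered_field ^ 'n"
  assumes sqrt: "\<And>x::'a. 0 \<le> x \<Longrightarrow> \<exists>y. y * y = x" and "v \<noteq> 0"
  shows "\<exists>u. parallel v u \<and> dot u u = 1"
proof -
  obtain y where y: "y * y = dot v v" using sqrt dot_self_nonneg by blast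
  with \<open>v \<noteq> 0\<close> have "y \<noteq> 0" by auto
  then have "dot (inverse y *s v) (inverse y *s v) = 1"
    by (simp add: y [symmetric] field_simps)
  with \<open>y \<noteq> 0\<close> show ?thesis
    using parallel_scale by (metis nonzero_imp_inverse_nonzero)
qed

subsection \<open>Maps preserving orthogonality\<close>

text \<open>An additive map preserves order because nonnegative elements are squares.\<close>

lemma ring_endomorphism_eq_id:
  fixes F :: "'a::archimedean_field \<Rightarrow> 'a"
  assumes sqrt: "\<And>x::'a. 0 \<le> x \<Longrightarrow> \<exists>y. y * y = x"
    and one: "F 1 = 1"
    and mult: "\<And>x y. F (x * y) = F x * F y"
    and add: "\<And>x y. F (x + y) = F x + F y"
  shows "F x = x"
proof (rule ccontr)
  assume neq: "F x \<noteq> x"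
  have diff: "F (x - y) = F x - F y" for x y
    using add [of "x - y" y] by (simp add: algebra_simps)
  have zero: "F 0 = 0"
    using diff [of 0 0] by simp
  have nonneg: "0 \<le> F z" if "0 \<le> z" for z
    using sqrt [OF that] mult by (metis zero_le_square)
  have mono: "F y \<le> F z" if "y \<le> z" for y z
    using nonneg [of "z - y"] that by (simp add: diff)
  have nat: "F (of_nat n) = of_nat n" for n
    by (induction n) (simp_all add: zero add one)
  have int: "F (of_int m) = of_int m" for m
    by (cases m rule: int_diff_cases) (simp add: diff nat)
  \<comment> \<open>By the Archimedean property some multiple of the gap exceeds 1, while
    monotonicity confines \<open>of_nat n * x\<close> and \<open>of_nat n * F x\<close> to the same
    unit interval.\<close>
  obtain n where n: "1 < of_nat n * \<bar>F x - x\<bar>"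
    using ex_less_of_nat_mult [of "\<bar>F x - x\<bar>"] neq by auto
  obtain m where m: "of_int m \<le> of_nat n * x" "of_nat n * x < of_int (m + 1)"
    using floor_exists by blast
  have "of_int m \<le> of_nat n * F x" "of_nat n * F x \<le> of_int (m + 1)"
    using mono [OF m(1)] mono [OF less_imp_le [OF m(2)]] by (simp_all only: int mult nat)
  with m have "\<bar>of_nat n * F x - of_nat n * x\<bar> \<le> 1"
    unfolding of_int_add of_int_1 by linarith
  then have "of_nat n * \<bar>F x - x\<bar> \<le> 1"
    by (simp add: abs_mult flip: right_diff_distrib)
  with n show False by simp
qed

text \<open>Orthogonality to vectors supported on two coordinates shows that the ratio of two
  coordinates of \<open>\<Phi> v\<close> depends only on the same ratio for \<open>v\<close>. Up to
  constants these ratio functions are a single ring endomorphism of the field, hence the identity,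
  and the constants are signs.\<close>

lemma orthogonality_preserving_diagonal:
  fixes \<Phi> :: "'a::archimedean_field ^ 3 \<Rightarrow> 'a ^ 3"
  assumes sqrt: "\<And>x::'a. 0 \<le> x \<Longrightarrow> \<exists>y. y * y = x"
    and nz: "\<And>v. v \<noteq> 0 \<Longrightarrow> \<Phi> v \<noteq> 0"
    and orth: "\<And>u v. u \<noteq> 0 \<Longrightarrow> v \<noteq> 0 \<Longrightarrow> dot (\<Phi> u) (\<Phi> v) = 0 \<longleftrightarrow> dot u v = 0"
    and axes: "\<And>i. parallel (axis i 1) (\<Phi> (axis i 1))"
  shows "\<exists>\<alpha> \<beta>. \<alpha> * \<alpha> = 1 \<and> \<beta> * \<beta> = 1 \<and>
           (\<forall>v. v \<noteq> 0 \<longrightarrow> parallel (vector [v $ 1, \<alpha> * v $ 2, \<alpha> * \<beta> * v $ 3]) (\<Phi> v))"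
proof -
  have comp: "\<Phi> v $ i = 0 \<longleftrightarrow> v $ i = 0" if "v \<noteq> 0" for v i
  proof -
    have "dot (\<Phi> v) (\<Phi> (axis i 1)) = 0 \<longleftrightarrow> v $ i = 0"
      using that by (simp add: orth axis_eq_0_iff)
    moreover have "dot (\<Phi> v) (\<Phi> (axis i 1)) = 0 \<longleftrightarrow> dot (\<Phi> v) (axis i 1) = 0"
      using axes dot_eq_0_parallel_cong parallel_refl by metis
    ultimately show ?thesis by simp
  qed
  define e :: "3 \<Rightarrow> 3 \<Rightarrow> 'a \<Rightarrow> 'a \<Rightarrow> 'a ^ 3" where
    "e i j x y = (\<chi> l. if l = i then x else if l = j then y else 0)" for i j x y
  have e_nz: "e i j x y \<noteq> 0" if "x \<noteq> 0" for i j x y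
    using that by (auto simp: e_def vec_eq_iff)
  have dot_two: "dot v w = v $ i * w $ i + v $ j * w $ j"
    if "i \<noteq> j" "\<And>l. l \<noteq> i \<Longrightarrow> l \<noteq> j \<Longrightarrow> w $ l = 0" for v w :: "'a ^ 3" and i j
  proof -
    have "dot v w = (\<Sum>l\<in>{i, j}. v $ l * w $ l)"
      unfolding dot_def by (rule sum.mono_neutral_right) (use that in auto)
    with that(1) show ?thesis by simp
  qed
  \<comment> \<open>\<open>g i j\<close> is the map of slopes that \<open>\<Phi>\<close> induces on
    the coordinate plane of \<open>i\<close> and \<open>j\<close>.\<close>
  define g where "g i j x = \<Phi> (e i j 1 x) $ j / \<Phi> (e i j 1 x) $ i" for i j x
  have ratio: "\<Phi> v $ j = g i j (v $ j / v $ i) * \<Phi> v $ i" if "i \<noteq> j" "v $ i \<noteq> 0" for v i j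
  proof -
    \<comment> \<open>In the coordinates \<open>i\<close> and \<open>j\<close> this is
      \<open>v\<close> turned by a right angle. Its image is again supported on these coordinates
      and is orthogonal to the images of both \<open>v\<close> and \<open>?u\<close>, which
      therefore have the same slope.\<close>
    let ?w = "e j i (- v $ i) (v $ j)"
    have w: "?w \<noteq> 0" "?w $ j \<noteq> 0" "\<And>l. l \<noteq> i \<Longrightarrow> l \<noteq> j \<Longrightarrow> ?w $ l = 0"
      using that e_nz by (auto simp: e_def)
    have *: "\<Phi> u $ i * \<Phi> ?w $ i + \<Phi> u $ j * \<Phi> ?w $ j = 0"
      if "u \<noteq> 0" "u $ j * v $ i = u $ i * v $ j" for u
    proof -
      have "dot u ?w = 0"
        using that \<open>i \<noteq> j\<close> by (subst dot_two [OF \<open>i \<noteq> j\<close>]) (auto simp: e_def)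
      then have "dot (\<Phi> u) (\<Phi> ?w) = 0"
        using orth that(1) w(1) by blast
      then show ?thesis
        using w by (subst (asm) dot_two [OF \<open>i \<noteq> j\<close>]) (auto simp: comp)
    qed
    have v: "v \<noteq> 0" using that by auto
    let ?u = "e i j 1 (v $ j / v $ i)"
    have u: "?u \<noteq> 0" "?u $ i \<noteq> 0"
      using e_nz [of 1] by (auto simp: e_def)
    have u': "?u $ j * v $ i = ?u $ i * v $ j"
      using that by (simp add: e_def)
    note eqs = * [OF v mult.commute] * [OF u(1) u']
    have nzs: "\<Phi> ?w $ j \<noteq> 0" "\<Phi> ?u $ i \<noteq> 0" "\<Phi> v $ i \<noteq> 0"
      using w u v that by (auto simp: comp)
    have "\<Phi> v $ j * \<Phi> ?u $ i * \<Phi> ?w $ j = \<Phi> ?u $ j * \<Phi> v $ i * \<Phi> ?w $ j"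
      using eqs by algebra
    with nzs show ?thesis
      by (simp add: g_def field_simps)
  qed
  have g_nz: "g i j x \<noteq> 0" if "i \<noteq> j" "x \<noteq> 0" for i j x
  proof -
    have "e i j 1 x \<noteq> 0" using e_nz [of 1] by simp
    with that show ?thesis by (simp add: g_def comp) (simp add: e_def)
  qed
  have g_zero: "g i j 0 = 0" if "i \<noteq> j" for i j
  proof -
    have "e i j 1 0 \<noteq> 0" using e_nz [of 1] by simp
    with that show ?thesis by (simp add: g_def comp) (simp add: e_def)
  qed
  \<comment> \<open>The slopes \<open>x\<close> and \<open>- 1 / x\<close> are
    perpendicular.\<close>
  have g_minus: "g i j x * g i j (- 1 / x) = - 1" if "i \<noteq> j" "x \<noteq> 0" for i j x
  proof -
    let ?u = "e i j 1 x" and ?v = "e i j 1 (- 1 / x)"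
    have nzs: "?u \<noteq> 0" "?v \<noteq> 0" using e_nz [of 1] by simp_all
    have 0: "l \<noteq> i \<Longrightarrow> l \<noteq> j \<Longrightarrow> ?v $ l = 0" for l by (simp add: e_def)
    have "dot ?u ?v = 0"
      using that by (subst dot_two [OF that(1) 0]) (auto simp: e_def)
    then have "dot (\<Phi> ?u) (\<Phi> ?v) = 0"
      using orth nzs by blast
    then have "\<Phi> ?u $ i * \<Phi> ?v $ i + \<Phi> ?u $ j * \<Phi> ?v $ j = 0"
      using 0 nzs by (subst (asm) dot_two [OF that(1)]) (auto simp: comp)
    moreover have "\<Phi> ?u $ i \<noteq> 0" "\<Phi> ?v $ i \<noteq> 0"
      using nzs by (simp_all add: comp) (simp_all add: e_def)
    ultimately show ?thesis
      by (simp add: g_def field_simps eq_neg_iff_add_eq_0)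
  qed
  have ne [simp]: "(1::3) \<noteq> 2" "(1::3) \<noteq> 3" "(2::3) \<noteq> 3"
    by simp_all
  \<comment> \<open>The coordinate ratios of the image of \<open>(1, x, xz)\<close> are compared in two ways.\<close>
  have g_mult: "g 1 3 (x * z) = g 1 2 x * g 2 3 z" for x z
  proof (cases "x = 0")
    case False
    define v :: "'a ^ 3" where "v = vector [1, x, x * z]"
    have v: "v $ 1 = 1" "v $ 2 = x" "v $ 3 = x * z"
      by (simp_all add: v_def)
    then have "v \<noteq> 0" by (metis zero_index one_neq_zero)
    then have "\<Phi> v $ 1 \<noteq> 0" by (simp add: comp v)
    moreover have "\<Phi> v $ 3 = g 1 3 (x * z) * \<Phi> v $ 1" "\<Phi> v $ 2 = g 1 2 x * \<Phi> v $ 1"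
      "\<Phi> v $ 3 = g 2 3 z * \<Phi> v $ 2"
      using ratio [of 1 3 v] ratio [of 1 2 v] ratio [of 2 3 v] False by (simp_all add: v)
    ultimately show ?thesis by (simp add: mult.commute)
  qed (simp add: g_zero)
  define \<alpha> \<beta> where "\<alpha> = g 1 2 1" and "\<beta> = g 2 3 1"
  have nz': "\<alpha> \<noteq> 0" "\<beta> \<noteq> 0" by (simp_all add: \<alpha>_def \<beta>_def g_nz)
  \<comment> \<open>Dividing by \<open>\<alpha>\<close> normalises the slope map to
    \<open>F 1 = 1\<close>; the three slope maps then differ only by the constants
    \<open>\<alpha>\<close>, \<open>\<beta>\<close> and \<open>\<alpha> * \<beta>\<close>.\<close>
  define F where "F x = g 1 2 x / \<alpha>" for x
  have g12: "g 1 2 x = \<alpha> * F x" for x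
    using nz' by (simp add: F_def)
  have g13: "g 1 3 x = \<alpha> * \<beta> * F x" for x
    using g_mult [of x 1] by (simp add: g12 \<beta>_def)
  have g23: "g 2 3 x = \<beta> * F x" for x
    using g_mult [of 1 x] nz' by (simp add: g13 \<alpha>_def [symmetric])
  have F1: "F 1 = 1"
    using nz' by (simp add: F_def \<alpha>_def)
  have F_mult: "F (x * y) = F x * F y" for x y
    using g_mult [of x y] nz' by (simp add: g12 g13 g23)
  \<comment> \<open>\<open>F (- 1)\<close> squares to 1, and the equation \<open>a\<close>, which
    comes from perpendicular slopes, forces it to be negative. Inserted back into \<open>a\<close>,
    the value gives \<open>\<alpha> * \<alpha> = 1\<close>.\<close>
  have "F (- 1) * F (- 1) = 1"
    using F_mult [of "- 1" "- 1"] F1 by simp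
  moreover have a: "\<alpha> * \<alpha> * F (- 1) = - 1"
    using g_minus [of 1 2 1] by (simp add: g12 F1 mult_ac)
  ultimately have Fm1: "F (- 1) = - 1"
    by (metis F1 mult.right_neutral neg_less_0_iff_less not_square_less_zero square_eq_1_iff zero_less_one)
  have \<alpha>: "\<alpha> * \<alpha> = 1"
    using a by (simp add: Fm1)
  have \<beta>: "\<beta> * \<beta> = 1"
    using g_minus [of 2 3 1] by (simp add: g23 F1 Fm1 mult_ac)
  have F_neg: "F (- x) = - F x" for x
    using F_mult [of "- 1" x] by (simp add: Fm1)
  have F_succ: "F (1 + x) = 1 + F x" for x
  proof -
    \<comment> \<open>\<open>(1, x, - 1 - x)\<close> is orthogonal to \<open>(1, 1, 1)\<close>.
      Since \<open>\<alpha>\<close> and \<open>\<beta>\<close> square to 1, orthogonality of the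
      images becomes \<open>1 + F x + F (- 1 - x) = 0\<close>.\<close>
    define v w :: "'a ^ 3" where "v = vector [1, x, - 1 - x]" and "w = vector [1, 1, 1]"
    have v: "v $ 1 = 1" "v $ 2 = x" "v $ 3 = - 1 - x" and w: "w $ 1 = 1" "w $ 2 = 1" "w $ 3 = 1"
      by (simp_all add: v_def w_def)
    have nzs: "v \<noteq> 0" "w \<noteq> 0" using v w by (metis zero_index one_neq_zero)+
    have "dot v w = 0" by (simp add: dot_def sum_3 v w)
    then have "dot (\<Phi> v) (\<Phi> w) = 0" using orth nzs by blast
    moreover have "\<Phi> v $ 2 = \<alpha> * F x * \<Phi> v $ 1" "\<Phi> v $ 3 = \<alpha> * \<beta> * F (- 1 - x) * \<Phi> v $ 1"
      "\<Phi> w $ 2 = \<alpha> * \<Phi> w $ 1" "\<Phi> w $ 3 = \<alpha> * \<beta> * \<Phi> w $ 1"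
      using ratio [of 1 3 v] ratio [of 1 2 v] ratio [of 1 3 w] ratio [of 1 2 w]
      by (simp_all add: v w g12 g13 F1)
    ultimately have "\<Phi> v $ 1 * \<Phi> w $ 1 * (1 + F x + F (- 1 - x)) = 0"
      using \<alpha> \<beta> unfolding dot_def sum_3 by algebra
    moreover have "\<Phi> v $ 1 \<noteq> 0" "\<Phi> w $ 1 \<noteq> 0"
      using nzs by (simp_all add: comp v w)
    ultimately have "1 + F x + F (- 1 - x) = 0"
      by simp
    moreover have "F (- 1 - x) = - F (1 + x)"
      using F_neg [of "1 + x"] by (simp add: algebra_simps)
    ultimately show ?thesis by simp
  qed
  have F_add: "F (x + y) = F x + F y" for x y
  proof (cases "x = 0")
    case True
    have "F 0 = 0" by (simp add: F_def g_zero)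
    with True show ?thesis by simp
  next
    case False
    \<comment> \<open>Factoring out \<open>x\<close> reduces addition to \<open>F_succ\<close> and
      multiplicativity.\<close>
    then have "F (x + y) = F (x * (1 + y / x))" by (simp add: distrib_left)
    also have "\<dots> = F x + F (x * (y / x))"
      by (simp only: F_mult F_succ) (simp add: algebra_simps)
    finally show ?thesis using False by simp
  qed
  have F_id: "F x = x" for x
    using ring_endomorphism_eq_id [OF sqrt F1 F_mult F_add] .
  have "parallel (vector [v $ 1, \<alpha> * v $ 2, \<alpha> * \<beta> * v $ 3]) (\<Phi> v)" if "v \<noteq> 0" for v
  proof -
    \<comment> \<open>The first nonzero coordinate serves as denominator of the ratios.\<close>
    consider "v $ 1 \<noteq> 0" | "v $ 1 = 0" "v $ 2 \<noteq> 0" | "v $ 1 = 0" "v $ 2 = 0" "v $ 3 \<noteq> 0"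
      using \<open>v \<noteq> 0\<close> by (force simp: vec_eq_iff forall_3)
    then show ?thesis
    proof cases
      case 1
      then have "\<Phi> v = (\<Phi> v $ 1 / v $ 1) *s vector [v $ 1, \<alpha> * v $ 2, \<alpha> * \<beta> * v $ 3]"
        using ratio [of 1 2 v] ratio [of 1 3 v]
        by (simp add: vec_eq_iff forall_3 g12 g13 F_id field_simps)
      with 1 show ?thesis
        using comp \<open>v \<noteq> 0\<close> unfolding parallel_def by (metis divide_eq_0_iff)
    next
      case 2
      then have "\<Phi> v = (\<Phi> v $ 2 / (\<alpha> * v $ 2)) *s vector [v $ 1, \<alpha> * v $ 2, \<alpha> * \<beta> * v $ 3]"
        using ratio [of 2 3 v] nz' \<open>v \<noteq> 0\<close>
        by (simp add: vec_eq_iff forall_3 g23 F_id field_simps comp)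
      moreover have "\<Phi> v $ 2 / (\<alpha> * v $ 2) \<noteq> 0"
        using 2 nz' comp \<open>v \<noteq> 0\<close> by simp
      ultimately show ?thesis
        unfolding parallel_def by metis
    next
      case 3
      then have "\<Phi> v = (\<Phi> v $ 3 / (\<alpha> * \<beta> * v $ 3)) *s vector [v $ 1, \<alpha> * v $ 2, \<alpha> * \<beta> * v $ 3]"
        using nz' \<open>v \<noteq> 0\<close> by (simp add: vec_eq_iff forall_3 comp)
      moreover have "\<Phi> v $ 3 / (\<alpha> * \<beta> * v $ 3) \<noteq> 0"
        using 3 nz' comp \<open>v \<noteq> 0\<close> by simp
      ultimately show ?thesis
        unfolding parallel_def by metis
    qed
  qed
  with \<alpha> \<beta> show ?thesis by blast
qed

text \<open>The images of the axes are pairwise orthogonal lines. An orthogonal matrix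
  \<open>M\<close> moves them back to the axes, so the diagonal case applies to
  \<open>M *v \<Phi> v\<close> and yields a diagonal sign matrix \<open>D\<close>; the matrix sought
  is \<open>transpose M ** D\<close>.\<close>

lemma orthogonality_preserving_imp_orthogonal_matrix:
  fixes \<Phi> :: "'a::archimedean_field ^ 3 \<Rightarrow> 'a ^ 3"
  assumes sqrt: "\<And>x::'a. 0 \<le> x \<Longrightarrow> \<exists>y. y * y = x"
    and nz: "\<And>v. v \<noteq> 0 \<Longrightarrow> \<Phi> v \<noteq> 0"
    and orth: "\<And>u v. u \<noteq> 0 \<Longrightarrow> v \<noteq> 0 \<Longrightarrow> dot (\<Phi> u) (\<Phi> v) = 0 \<longleftrightarrow> dot u v = 0"
  shows "\<exists>M. orthogonal_matrix M \<and> (\<forall>v. v \<noteq> 0 \<longrightarrow> parallel (M *v v) (\<Phi> v))"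
proof -
  have "\<exists>u. parallel (\<Phi> (axis i 1)) u \<and> dot u u = 1" for i
    by (rule unit_multiple_exists [OF sqrt]) (simp_all add: nz axis_eq_0_iff)
  then obtain u where u: "\<And>i. parallel (\<Phi> (axis i 1)) (u i)" "\<And>i. dot (u i) (u i) = 1"
    by metis
  have orthonormal: "dot (u i) (u j) = (if i = j then 1 else 0)" for i j
  proof (cases "i = j")
    case False
    then have "dot (\<Phi> (axis i 1)) (\<Phi> (axis j 1)) = 0"
      by (simp add: orth axis_eq_0_iff) (simp add: axis_def)
    with False show ?thesis
      using u(1) dot_eq_0_parallel_cong by metis
  qed (simp add: u)
  \<comment> \<open>The rows are the orthonormal vectors \<open>u i\<close>, so \<open>M\<close>
    sends \<open>u i\<close> to the axis of index \<open>i\<close>.\<close>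
  define M :: "'a ^ 3 ^ 3" where "M = (\<chi> i. u i)"
  have MMt: "M ** transpose M = mat 1"
    using orthonormal by (simp add: M_def matrix_matrix_mult_def transpose_def mat_def vec_eq_iff dot_def)
  then have M: "orthogonal_matrix M"
    by (simp add: orthogonal_matrix_def matrix_left_right_inverse)
  have M_axis: "M *v u i = axis i 1" for i
    using orthonormal [of _ i]
    by (simp add: M_def matrix_vector_mult_def vec_eq_iff dot_def axis_def)
  have M_parallel: "parallel (M *v v) (M *v w)" if "parallel v w" for v w
    using that by (auto simp: parallel_def vector_scalar_commute)
  define \<Psi> where "\<Psi> v = M *v \<Phi> v" for v
  have "\<exists>\<alpha> \<beta>. \<alpha> * \<alpha> = 1 \<and> \<beta> * \<beta> = 1 \<and>
          (\<forall>v. v \<noteq> 0 \<longrightarrow> parallel (vector [v $ 1, \<alpha> * v $ 2, \<alpha> * \<beta> * v $ 3]) (\<Psi> v))"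
  proof (rule orthogonality_preserving_diagonal [OF sqrt])
    show "\<Psi> v \<noteq> 0" if "v \<noteq> 0" for v
      using nz [OF that] dot_orthogonal_matrix [OF M] unfolding \<Psi>_def
      by (metis dot_self_eq_0_iff)
    show "dot (\<Psi> v) (\<Psi> w) = 0 \<longleftrightarrow> dot v w = 0" if "v \<noteq> 0" "w \<noteq> 0" for v w
      using that by (simp add: \<Psi>_def dot_orthogonal_matrix [OF M] orth)
    show "parallel (axis i 1) (\<Psi> (axis i 1))" for i
      using M_parallel [OF u(1) [of i]] by (simp add: M_axis \<Psi>_def parallel_sym)
  qed
  then obtain \<alpha> \<beta> where ab: "\<alpha> * \<alpha> = 1" "\<beta> * \<beta> = 1"
    and par: "\<And>v. v \<noteq> 0 \<Longrightarrow> parallel (vector [v $ 1, \<alpha> * v $ 2, \<alpha> * \<beta> * v $ 3]) (\<Psi> v)"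
    by blast
  define D :: "'a ^ 3 ^ 3" where
    "D = vector [vector [1, 0, 0], vector [0, \<alpha>, 0], vector [0, 0, \<alpha> * \<beta>]]"
  have "\<alpha> * \<beta> * (\<alpha> * \<beta>) = 1"
    using ab by algebra
  then have DD: "transpose D ** D = mat 1"
    using ab by (simp add: D_def matrix_matrix_mult_def transpose_def mat_def vec_eq_iff forall_3 sum_3)
  have D: "orthogonal_matrix D"
    using DD by (simp add: orthogonal_matrix_def matrix_left_right_inverse)
  have Dv: "D *v v = vector [v $ 1, \<alpha> * v $ 2, \<alpha> * \<beta> * v $ 3]" for v
    by (simp add: D_def matrix_vector_mult_def vec_eq_iff forall_3 sum_3)
  have "orthogonal_matrix (transpose M ** D)"
  proof -
    have "transpose M ** D ** (transpose D ** M) = transpose M ** (D ** transpose D) ** M"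
      by (simp add: matrix_mul_assoc)
    then have "transpose M ** D ** transpose (transpose M ** D) = mat 1"
      using M D by (simp add: orthogonal_matrix_def matrix_transpose_mul transpose_transpose)
    then show ?thesis
      by (simp add: orthogonal_matrix_def matrix_left_right_inverse)
  qed
  moreover have "parallel ((transpose M ** D) *v v) (\<Phi> v)" if "v \<noteq> 0" for v
  proof -
    have tM: "transpose M *v \<Psi> v = \<Phi> v"
      using M by (simp add: \<Psi>_def matrix_vector_mul_assoc orthogonal_matrix_def)
    obtain t where "t \<noteq> 0" "\<Psi> v = t *s (D *v v)"
      using par [OF \<open>v \<noteq> 0\<close>] by (auto simp: Dv parallel_def)
    then have "\<Phi> v = t *s ((transpose M ** D) *v v)"
      using tM by (simp add: vector_scalar_commute matrix_vector_mul_assoc)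
    with \<open>t \<noteq> 0\<close> show ?thesis by (auto simp: parallel_def)
  qed
  ultimately show ?thesis by blast
qed

subsection \<open>A countable field of real numbers\<close>

text \<open>Variable-free terms are countable, hence so are their values, and closure under the
  operations is immediate. Square root and inverse are total on the reals, so no side conditions
  arise.\<close>

datatype expr = One | Pi | Add expr expr | Neg expr | Mult expr expr | Inv expr | Sqrt expr | Cos expr

instance expr :: countable
  by countable_datatype

primrec expr_val :: "expr \<Rightarrow> real" where
  "expr_val One = 1"
| "expr_val Pi = pi"
| "expr_val (Add a b) = expr_val a + expr_val b"
| "expr_val (Neg a) = - expr_val a"
| "expr_val (Mult a b) = expr_val a * expr_val b"
| "expr_val (Inv a) = inverse (expr_val a)"
| "expr_val (Sqrt a) = sqrt (expr_val a)"
| "expr_val (Cos a) = cos (expr_val a)"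

text \<open>Making the field a type allows it to instantiate the classes under which the lemmas on
  vectors are stated.\<close>

typedef elem_real = "range expr_val"
  morphisms real_of_elem elem_of_real
  by blast

setup_lifting type_definition_elem_real

lemma range_expr_val_closed:
  "1 \<in> range expr_val" "pi \<in> range expr_val"
  "x \<in> range expr_val \<Longrightarrow> y \<in> range expr_val \<Longrightarrow> x + y \<in> range expr_val"
  "x \<in> range expr_val \<Longrightarrow> - x \<in> range expr_val"
  "x \<in> range expr_val \<Longrightarrow> y \<in> range expr_val \<Longrightarrow> x * y \<in> range expr_val"
  "x \<in> range expr_val \<Longrightarrow> inverse x \<in> range expr_val"
  "x \<in> range expr_val \<Longrightarrow> sqrt x \<in> range expr_val"
  "x \<in> range expr_val \<Longrightarrow> cos x \<in> range expr_val"
  by ((rule range_eqI, rule expr_val.simps [symmetric]) | (clarify, rule range_eqI, rule expr_val.simps [symmetric]))+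

lemma range_expr_val_0: "0 \<in> range expr_val"
  using range_expr_val_closed(3) [OF range_expr_val_closed(1) range_expr_val_closed(4) [OF range_expr_val_closed(1)]]
  by simp

lemma range_expr_val_diff: "x \<in> range expr_val \<Longrightarrow> y \<in> range expr_val \<Longrightarrow> x - y \<in> range expr_val"
  using range_expr_val_closed(3) [of x "- y"] range_expr_val_closed(4) by simp

lemma range_expr_val_divide: "x \<in> range expr_val \<Longrightarrow> y \<in> range expr_val \<Longrightarrow> x / y \<in> range expr_val"
  using range_expr_val_closed(5) [of x "inverse y"] range_expr_val_closed(6)
  by (simp add: divide_inverse)

lemma range_expr_val_of_nat: "of_nat n \<in> range expr_val"
  by (induction n) (simp_all add: range_expr_val_0 range_expr_val_closed)

lemma range_expr_val_sin:
  assumes "x \<in> range expr_val"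
  shows "sin x \<in> range expr_val"
proof -
  have "pi / of_nat 2 - x \<in> range expr_val"
    by (intro range_expr_val_diff range_expr_val_divide range_expr_val_of_nat
        range_expr_val_closed assms)
  then show ?thesis
    using range_expr_val_closed(8) by (simp add: sin_cos_eq)
qed

instantiation elem_real :: linordered_field
begin

lift_definition zero_elem_real :: elem_real is 0
  by (rule range_expr_val_0)
lift_definition one_elem_real :: elem_real is 1
  by (rule range_expr_val_closed)
lift_definition plus_elem_real :: "elem_real \<Rightarrow> elem_real \<Rightarrow> elem_real" is "(+)"
  by (rule range_expr_val_closed)
lift_definition minus_elem_real :: "elem_real \<Rightarrow> elem_real \<Rightarrow> elem_real" is "(-)"
  by (rule range_expr_val_diff)
lift_definition uminus_elem_real :: "elem_real \<Rightarrow> elem_real" is uminus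
  by (rule range_expr_val_closed)
lift_definition times_elem_real :: "elem_real \<Rightarrow> elem_real \<Rightarrow> elem_real" is "(*)"
  by (rule range_expr_val_closed)
lift_definition inverse_elem_real :: "elem_real \<Rightarrow> elem_real" is inverse
  by (rule range_expr_val_closed)
lift_definition divide_elem_real :: "elem_real \<Rightarrow> elem_real \<Rightarrow> elem_real" is "(/)"
  by (rule range_expr_val_divide)
lift_definition less_eq_elem_real :: "elem_real \<Rightarrow> elem_real \<Rightarrow> bool" is "(\<le>)" .
lift_definition less_elem_real :: "elem_real \<Rightarrow> elem_real \<Rightarrow> bool" is "(<)" .
lift_definition abs_elem_real :: "elem_real \<Rightarrow> elem_real" is abs
  by (metis abs_if range_expr_val_closed(4))
lift_definition sgn_elem_real :: "elem_real \<Rightarrow> elem_real" is sgn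
  by (simp add: sgn_if range_expr_val_0 range_expr_val_closed)

instance
  by standard
    (transfer; auto simp: field_simps sgn_if abs_if mult_less_cancel_left_pos)+

end

lemma real_of_elem_of_nat [simp]: "real_of_elem (of_nat n) = of_nat n"
  by (induction n) (simp_all add: zero_elem_real.rep_eq one_elem_real.rep_eq plus_elem_real.rep_eq)

instance elem_real :: archimedean_field
proof
  fix x :: elem_real
  obtain n :: nat where "real_of_elem x \<le> of_nat n"
    using real_arch_simple by blast
  then have "x \<le> of_int (int n)"
    by (simp add: less_eq_elem_real.rep_eq)
  then show "\<exists>z. x \<le> of_int z" ..
qed

instance elem_real :: countable
proof
  have "countable (range expr_val)"
    by simp
  then obtain f :: "real \<Rightarrow> nat" where "inj_on f (range expr_val)"
    by (auto simp: countable_def)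
  then have "inj (f \<circ> real_of_elem)"
    by (metis comp_inj_on inj_def inj_onI real_of_elem_inject type_definition.Rep_range
        type_definition_elem_real)
  then show "\<exists>f :: elem_real \<Rightarrow> nat. inj f" by blast
qed

lemma elem_real_sqrt_ex:
  assumes "0 \<le> x"
  shows "\<exists>y. y * y = (x :: elem_real)"
proof -
  have "sqrt (real_of_elem x) \<in> range expr_val"
    using range_expr_val_closed(7) real_of_elem by blast
  then have "real_of_elem (elem_of_real (sqrt (real_of_elem x))) = sqrt (real_of_elem x)"
    by (rule elem_of_real_inverse)
  with assms have "elem_of_real (sqrt (real_of_elem x)) * elem_of_real (sqrt (real_of_elem x)) = x"
    by (simp add: real_of_elem_inject [symmetric] times_elem_real.rep_eq
        less_eq_elem_real.rep_eq zero_elem_real.rep_eq)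
  then show ?thesis ..
qed

text \<open>The sequences stand for the cosine and sine of \<open>n\<pi> / 2k\<close>.\<close>

locale angle_subdivision =
  fixes k :: nat and C S :: "nat \<Rightarrow> elem_real"
  assumes k: "3 \<le> k"
    and C_0 [simp]: "C 0 = 1" and S_0 [simp]: "S 0 = 0"
    and C_Suc: "\<And>n. C (Suc n) = C n * C 1 - S n * S 1"
    and S_Suc: "\<And>n. S (Suc n) = S n * C 1 + C n * S 1"
    and unit: "\<And>n. (C n)\<^sup>2 + (S n)\<^sup>2 = 1"
    and C_pos: "\<And>n. n < k \<Longrightarrow> 0 < C n"
    and S_nonneg: "\<And>n. n \<le> k \<Longrightarrow> 0 \<le> S n"
    and C_k: "C k = 0"
    and S_1: "0 < S 1"

lemma angle_subdivision_exists:
  assumes "3 \<le> k"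
  shows "\<exists>C S. angle_subdivision k C S"
proof -
  define \<theta> where "\<theta> n = of_nat n * (pi / of_nat (2 * k))" for n
  define C where "C n = elem_of_real (cos (\<theta> n))" for n
  define S where "S n = elem_of_real (sin (\<theta> n))" for n
  have \<theta>: "\<theta> n \<in> range expr_val" for n
    unfolding \<theta>_def
    by (intro range_expr_val_closed range_expr_val_divide range_expr_val_of_nat)
  have C: "real_of_elem (C n) = cos (\<theta> n)" for n
    unfolding C_def by (intro elem_of_real_inverse range_expr_val_closed \<theta>)
  have S: "real_of_elem (S n) = sin (\<theta> n)" for n
    unfolding S_def by (intro elem_of_real_inverse range_expr_val_sin \<theta>)
  have \<theta>_Suc: "\<theta> (Suc n) = \<theta> n + \<theta> 1" for n
    by (simp add: \<theta>_def distrib_right add_divide_distrib)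
  have \<theta>_nonneg: "0 \<le> \<theta> n" for n
    by (simp add: \<theta>_def)
  have \<theta>_k: "\<theta> k = pi / 2"
    using assms by (simp add: \<theta>_def)
  have \<theta>_less: "\<theta> m < \<theta> n" if "m < n" for m n
    unfolding \<theta>_def using that assms by (intro mult_strict_right_mono) auto
  note rep = real_of_elem_inject [symmetric] less_eq_elem_real.rep_eq less_elem_real.rep_eq
    plus_elem_real.rep_eq minus_elem_real.rep_eq times_elem_real.rep_eq
    zero_elem_real.rep_eq one_elem_real.rep_eq C S
  have "angle_subdivision k C S"
  proof
    show "C (Suc n) = C n * C 1 - S n * S 1" "S (Suc n) = S n * C 1 + C n * S 1" for n
      unfolding rep \<theta>_Suc [of n] by (simp_all add: cos_add sin_add)
    show "(C n)\<^sup>2 + (S n)\<^sup>2 = 1" for n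
      by (simp add: rep power2_eq_square flip: cos_squared_eq)
    show "0 < C n" if "n < k" for n
      using \<theta>_less [OF that] \<theta>_k \<theta>_nonneg [of n] by (simp add: rep cos_gt_zero_pi)
    show "0 \<le> S n" if "n \<le> k" for n
    proof -
      have "\<theta> n \<le> \<theta> k"
        using \<theta>_less [of n k] that by (cases "n = k") auto
      then have "0 \<le> sin (\<theta> n)"
        using \<theta>_k \<theta>_nonneg [of n] pi_gt_zero by (intro sin_ge_zero) linarith+
      then show ?thesis by (simp add: rep)
    qed
    show "0 < S 1"
      using \<theta>_less [of 0 1] \<theta>_less [of 1 k] assms \<theta>_k \<theta>_nonneg [of 0] pi_gt_zero
      unfolding rep by (intro sin_gt_zero) auto
  qed (use assms in \<open>auto simp: rep \<theta>_k\<close>, auto simp: \<theta>_def)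
  then show ?thesis by blast
qed

subsection \<open>Angles between unit vectors\<close>

text \<open>The reflection in the plane of \<open>u\<close> and \<open>v\<close> maps
  \<open>w\<close> to another common neighbour, so by uniqueness it fixes the line of
  \<open>w\<close>. Hence \<open>w\<close> lies in that plane, and \<open>v\<close> is the mirror
  image of \<open>u\<close> in the line of \<open>w\<close>.\<close>

lemma reflection_to_common_neighbour:
  fixes u v w :: "'a::linordered_field ^ 3"
  assumes units: "dot u u = 1" "dot v v = 1" "dot w w = 1"
    and dots: "dot u w = c" "dot w v = c" "c \<noteq> 0" and uv: "\<not> parallel u v"
    and unique: "\<And>x. dot x x = 1 \<Longrightarrow> dot u x = c \<Longrightarrow> dot x v = c \<Longrightarrow> parallel w x"
  shows "v = (2 * c) *s w - u"
proof -
  have nz: "u \<noteq> 0" "v \<noteq> 0" "w \<noteq> 0"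
    using units by auto
  define n where "n = cross u v"
  have n: "dot u n = 0" "dot v n = 0" "dot n u = 0" "dot n v = 0"
    by (simp_all add: n_def)
  have "n \<noteq> 0"
    unfolding n_def using nz uv by (intro cross_neq_0)
  then have nn: "dot n n \<noteq> 0" by simp
  \<comment> \<open>This is the image of \<open>w\<close> under the reflection in the plane with
    normal \<open>n\<close>.\<close>
  define x where "x = w - (2 * dot w n / dot n n) *s n"
  have "dot x x = 1"
    using nn units(3) dot_commute [of n w] by (simp add: x_def field_simps)
  moreover have ux: "dot u x = c" and "dot x v = c"
    using dots n by (simp_all add: x_def)
  ultimately obtain t where "t \<noteq> 0" "x = t *s w"
    using unique by (auto simp: parallel_def)
  with ux dots have "t = 1" by simp
  with \<open>x = t *s w\<close> have "x = w" by simp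
  have "dot x n = - dot w n"
    using nn by (simp add: x_def)
  with \<open>x = w\<close> have wn: "dot w n = 0" by simp
  have "u \<noteq> v" using uv by auto
  \<comment> \<open>The difference is orthogonal to \<open>w\<close>, \<open>n\<close> and
    \<open>u - v\<close>, which are pairwise orthogonal.\<close>
  have "v - ((2 * c) *s w - u) = 0"
  proof (rule orthogonal_to_orthogonal_triple)
    show "w \<noteq> 0" "n \<noteq> 0" "u - v \<noteq> 0" "dot w n = 0"
      using nz \<open>n \<noteq> 0\<close> \<open>u \<noteq> v\<close> wn by simp_all
  qed (use n dots units wn dot_commute [of w u] dot_commute [of v u] dot_commute [of v w] in \<open>simp_all\<close>)
  then show ?thesis by simp
qed

text \<open>If \<open>dot u w\<close> and \<open>dot w v\<close> had opposite signs, Cauchy-Schwarz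
  for \<open>w\<close> and \<open>u - v\<close> would contradict \<open>1 < 2 * c\<^sup>2\<close>.
  With equal signs, \<open>w\<close> and \<open>u + v\<close> are in the equality case of
  Cauchy-Schwarz.\<close>

lemma common_neighbour_unique:
  fixes u v w :: "'a::linordered_field ^ 'n"
  assumes units: "dot u u = 1" "dot v v = 1" "dot w w = 1"
    and uv: "dot u v = 2 * c\<^sup>2 - 1" and c: "1 < 2 * c\<^sup>2"
    and w: "(dot u w)\<^sup>2 = c\<^sup>2" "(dot w v)\<^sup>2 = c\<^sup>2"
  shows "parallel (u + v) w"
proof -
  have c0: "c \<noteq> 0" using c by auto
  have sq: "\<And>x. x\<^sup>2 = c\<^sup>2 \<Longrightarrow> x = c \<or> x = - c"
    by (simp add: power2_eq_iff)
  have vu: "dot v u = 2 * c\<^sup>2 - 1" using uv dot_commute by metis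
  have "dot u w = dot w v"
  proof (rule ccontr)
    assume "dot u w \<noteq> dot w v"
    then have "(dot w (u - v))\<^sup>2 = 4 * c\<^sup>2"
      using sq [OF w(1)] sq [OF w(2)] dot_commute [of w u] by (auto simp: power2_eq_square)
    moreover have "(dot w (u - v))\<^sup>2 \<le> dot w w * dot (u - v) (u - v)"
      by (rule dot_Cauchy_Schwarz)
    ultimately have "4 * c\<^sup>2 \<le> 4 - 4 * c\<^sup>2"
      using units uv vu by simp
    with c show False by simp
  qed
  then have "(dot w (u + v))\<^sup>2 = dot w w * dot (u + v) (u + v)"
    using sq [OF w(1)] units uv vu dot_commute [of w u] by (auto simp: power2_eq_square)
  moreover have "dot (u + v) (u + v) = 4 * c\<^sup>2"
    using units uv vu by simp
  then have "u + v \<noteq> 0"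
    using c0 by (metis dot_simps(9) mult_eq_0_iff power_not_zero zero_neq_numeral)
  moreover have "w \<noteq> 0" using units by auto
  ultimately show ?thesis
    using dot_square_eq_iff_parallel parallel_sym by blast
qed

text \<open>The apex is a multiple of \<open>u + v\<close> plus a multiple of the normal
  \<open>cross u v\<close>. The first coefficient is determined by the product \<open>c\<close> with
  \<open>u\<close> and \<open>v\<close>, the second by unit length; the bound on
  \<open>dot u v\<close> makes the radicand nonnegative.\<close>

lemma isosceles_apex_exists:
  fixes u v :: "'a::linordered_field ^ 3"
  assumes sqrt: "\<And>x::'a. 0 \<le> x \<Longrightarrow> \<exists>y. y * y = x"
    and units: "dot u u = 1" "dot v v = 1"
    and uv: "0 \<le> dot u v" "dot u v < 1" "2 * c\<^sup>2 - 1 \<le> dot u v"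
  shows "\<exists>w. dot w w = 1 \<and> dot u w = c \<and> dot w v = c"
proof -
  define \<sigma> where "\<sigma> = dot u v"
  have \<sigma>: "dot u v = \<sigma>" "dot v u = \<sigma>" "0 \<le> \<sigma>" "\<sigma> < 1" "2 * c\<^sup>2 \<le> 1 + \<sigma>"
    using uv by (simp_all add: \<sigma>_def dot_commute [of v u])
  have pos: "0 < 1 + \<sigma>" "0 < 1 - \<sigma>\<^sup>2"
    using \<sigma> abs_square_less_1 [of \<sigma>] by simp_all
  have "0 \<le> (1 - 2 * c\<^sup>2 / (1 + \<sigma>)) / (1 - \<sigma>\<^sup>2)"
    using pos \<sigma> by simp
  then obtain b where b: "b * b = (1 - 2 * c\<^sup>2 / (1 + \<sigma>)) / (1 - \<sigma>\<^sup>2)"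
    using sqrt by blast
  define n where "n = cross u v"
  have n: "dot u n = 0" "dot v n = 0" "dot n u = 0" "dot n v = 0" "dot n n = 1 - \<sigma>\<^sup>2"
    by (simp_all add: n_def dot_cross_cross units \<sigma>)
  define a where "a = c / (1 + \<sigma>)"
  have a: "a * (1 + \<sigma>) = c" using pos by (simp add: a_def)
  define w where "w = a *s (u + v) + b *s n"
  have "dot w w = 2 * (a * (a * (1 + \<sigma>))) + b * b * (1 - \<sigma>\<^sup>2)"
    by (simp add: w_def n units \<sigma> algebra_simps)
  also have "\<dots> = 1"
    using pos by (simp only: b a) (simp add: a_def power2_eq_square)
  finally have "dot w w = 1" .
  moreover have "dot u w = c" "dot w v = c"
    using a by (simp_all add: w_def n units \<sigma> algebra_simps)
  ultimately show ?thesis by blast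
qed

text \<open>Gram-Schmidt gives a unit vector \<open>n\<close> orthogonal to \<open>u\<close> in the
  plane of \<open>u\<close> and \<open>v\<close>, and \<open>w\<close> is \<open>u\<close> turned
  towards \<open>n\<close>. The last equation is the cosine formula for a difference of angles, with
  \<open>\<tau>\<close> as the sine belonging to \<open>dot u v\<close>.\<close>

lemma geodesic_step_exists:
  fixes u v :: "'a::linordered_field ^ 'n"
  assumes units: "dot u u = 1" "dot v v = 1"
    and \<tau>: "\<tau> \<noteq> 0" "\<tau>\<^sup>2 = 1 - (dot u v)\<^sup>2" and cs: "c\<^sup>2 + s\<^sup>2 = 1"
  shows "\<exists>w. dot w w = 1 \<and> dot u w = c \<and> dot w v = c * dot u v + s * \<tau>"
proof (intro exI conjI)
  define n where "n = inverse \<tau> *s (v - dot u v *s u)"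
  have vu: "dot v u = dot u v" by (rule dot_commute)
  have un: "dot u n = 0" "dot n u = 0"
    by (simp_all add: n_def units vu)
  have nv: "dot n v = \<tau>"
    using \<tau> by (simp add: n_def units vu field_simps power2_eq_square)
  have nn: "dot n n = 1"
  proof -
    have "dot n n = inverse \<tau> * (dot n v - dot u v * dot n u)"
      by (subst (2) n_def) simp
    with \<tau> show ?thesis by (simp add: nv un)
  qed
  let ?w = "c *s u + s *s n"
  show "dot ?w ?w = 1" "dot u ?w = c" "dot ?w v = c * dot u v + s * \<tau>"
    using cs by (simp_all add: un nn nv units power2_eq_square)
qed

text \<open>This is the spherical triangle inequality in terms of cosines. It follows from
  Cauchy-Schwarz for the components of \<open>u\<close> and \<open>v\<close> orthogonal to
  \<open>w\<close>.\<close>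

lemma dot_ge_of_two_steps:
  fixes u v w :: "'a::linordered_field ^ 'n"
  assumes units: "dot u u = 1" "dot v v = 1" "dot w w = 1"
    and uw: "C \<le> dot u w" "0 \<le> C" and CS: "C\<^sup>2 + S\<^sup>2 = 1" "0 \<le> S"
    and wv: "dot w v = c" "0 \<le> c" and cs: "c\<^sup>2 + s\<^sup>2 = 1" "0 \<le> s"
  shows "C * c - S * s \<le> dot u v"
proof -
  define a where "a = dot u w"
  have dots: "dot u w = a" "dot w u = a" "dot v w = c"
    using wv by (simp_all add: a_def dot_commute [of w u] dot_commute [of v w])
  have "(dot (u - a *s w) (v - c *s w))\<^sup>2
      \<le> dot (u - a *s w) (u - a *s w) * dot (v - c *s w) (v - c *s w)"
    by (rule dot_Cauchy_Schwarz)
  then have "(dot u v - a * c)\<^sup>2 \<le> (1 - a\<^sup>2) * (1 - c\<^sup>2)"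
    by (simp add: dots wv units power2_eq_square algebra_simps)
  also have "\<dots> = (1 - a\<^sup>2) * s\<^sup>2"
  proof -
    have "1 - c\<^sup>2 = s\<^sup>2" using cs(1) by (simp add: algebra_simps)
    then show ?thesis by simp
  qed
  also have "\<dots> \<le> S\<^sup>2 * s\<^sup>2"
  proof (rule mult_right_mono)
    have "C\<^sup>2 \<le> a\<^sup>2" using uw by (intro power_mono) (simp_all add: a_def)
    then show "1 - a\<^sup>2 \<le> S\<^sup>2" using CS by (simp add: algebra_simps)
  qed simp
  finally have "\<bar>dot u v - a * c\<bar> \<le> \<bar>S * s\<bar>"
    by (simp add: abs_le_square_iff power_mult_distrib)
  then have "a * c - S * s \<le> dot u v"
    using mult_nonneg_nonneg [OF CS(2) cs(2)] by (simp add: abs_if split: if_splits)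
  moreover have "C * c \<le> a * c"
    using uw wv by (intro mult_right_mono) (simp_all add: a_def)
  ultimately show ?thesis by simp
qed

text \<open>Both sides are cosines of differences: the angle of \<open>(c, s)\<close> is subtracted
  from those of \<open>(C, S)\<close> and \<open>(\<sigma>, \<tau>)\<close>. After multiplication by
  the positive number \<open>S + \<tau>\<close>, the identity
  \<open>\<sigma>\<^sup>2 - C\<^sup>2 = S\<^sup>2 - \<tau>\<^sup>2\<close> reduces the claim to
  signs of sines.\<close>

lemma cos_diff_antimono:
  fixes c s C S \<sigma> \<tau> :: "'a::linordered_field"
  assumes cs: "c\<^sup>2 + s\<^sup>2 = 1" "0 \<le> s" and CS: "C\<^sup>2 + S\<^sup>2 = 1" "0 \<le> S"
    and \<sigma>: "C \<le> \<sigma>" "0 \<le> \<sigma>" "\<sigma> \<le> c" and \<tau>: "0 < \<tau>" "\<tau>\<^sup>2 = 1 - \<sigma>\<^sup>2"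
    and sin_diff: "0 \<le> c * S - s * C"
  shows "C * c + S * s \<le> c * \<sigma> + s * \<tau>"
proof -
  have "\<sigma>\<^sup>2 \<le> c\<^sup>2" using \<sigma>(3,2) by (rule power_mono)
  then have "s\<^sup>2 \<le> \<tau>\<^sup>2" using \<tau>(2) cs(1) by (simp add: algebra_simps)
  then have "s \<le> \<tau>" using less_imp_le [OF \<tau>(1)] by (rule power2_le_imp_le)
  then have "s * \<sigma> \<le> \<tau> * c"
    using \<sigma> \<tau>(1) by (intro mult_mono) simp_all
  with sin_diff have "0 \<le> c * (S + \<tau>) - s * (\<sigma> + C)"
    by (simp add: algebra_simps)
  then have "0 \<le> (\<sigma> - C) * (c * (S + \<tau>) - s * (\<sigma> + C))"
    using \<sigma>(1) by (intro mult_nonneg_nonneg) simp_all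
  also have "\<dots> = (\<sigma> - C) * c * (S + \<tau>) - s * (\<sigma>\<^sup>2 - C\<^sup>2)"
    by (simp add: algebra_simps power2_eq_square)
  also have "\<sigma>\<^sup>2 - C\<^sup>2 = S\<^sup>2 - \<tau>\<^sup>2"
    using \<tau>(2) CS(1) by (simp add: algebra_simps)
  also have "(\<sigma> - C) * c * (S + \<tau>) - s * (S\<^sup>2 - \<tau>\<^sup>2) = ((\<sigma> - C) * c - (S - \<tau>) * s) * (S + \<tau>)"
    by (simp add: algebra_simps power2_eq_square)
  finally have "0 \<le> ((\<sigma> - C) * c - (S - \<tau>) * s) * (S + \<tau>)" .
  moreover have "0 < S + \<tau>" using CS(2) \<tau>(1) by simp
  ultimately have "0 \<le> (\<sigma> - C) * c - (S - \<tau>) * s"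
    by (meson mult_neg_pos not_le)
  then show ?thesis
    by (simp add: algebra_simps)
qed

subsection \<open>Paths and automorphisms\<close>

lemma path_connects_Cons:
  assumes "path_connects V E vs w v" "u \<in> V" "{u, w} \<in> E"
  shows "path_connects V E (u # vs) u v" "path_length (u # vs) = Suc (path_length vs)"
proof -
  have vs: "vs \<noteq> []" "set vs \<subseteq> V" "hd vs = w" "last vs = v"
    and e: "\<And>i. Suc i < length vs \<Longrightarrow> {vs ! i, vs ! Suc i} \<in> E"
    using assms(1) by (auto simp: path_connects_def graph_path_def)
  have "{(u # vs) ! i, (u # vs) ! Suc i} \<in> E" if "Suc i < length (u # vs)" for i
    using that e assms(3) vs by (cases i) (auto simp: hd_conv_nth)
  with vs assms(2) show "path_connects V E (u # vs) u v"
    by (auto simp: path_connects_def graph_path_def)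
  show "path_length (u # vs) = Suc (path_length vs)"
    using vs(1) by (simp add: path_length_def)
qed

lemma path_connects_singleton: "u \<in> V \<Longrightarrow> path_connects V E [u] u u"
  by (simp add: path_connects_def graph_path_def)

lemma graph_diameter_eqI:
  assumes "\<And>u v. u \<in> V \<Longrightarrow> v \<in> V \<Longrightarrow> \<exists>vs. path_connects V E vs u v \<and> path_length vs \<le> k"
    and "u \<in> V" "v \<in> V" "\<And>vs. path_connects V E vs u v \<Longrightarrow> k \<le> path_length vs"
  shows "graph_diameter V E = enat k"
  unfolding graph_diameter_def
proof (rule Least_equality)
  show "\<forall>u\<in>V. \<forall>v\<in>V. \<exists>vs. path_connects V E vs u v \<and> enat (path_length vs) \<le> enat k"
    using assms(1) by simp
next
  fix l assume "\<forall>u\<in>V. \<forall>v\<in>V. \<exists>vs. path_connects V E vs u v \<and> enat (path_length vs) \<le> l"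
  then obtain vs where "path_connects V E vs u v" "enat (path_length vs) \<le> l"
    using assms by blast
  then show "enat k \<le> l"
    using assms(4) by (meson enat_ord_simps(1) order_trans)
qed

text \<open>In the graph of the angle \<pi> / 2k with k at least 3, this says that \<open>b\<close>
  is the middle of two consecutive steps along a geodesic from \<open>a\<close> to
  \<open>d\<close>.\<close>

definition unique_middle :: "'a set \<Rightarrow> 'a set set \<Rightarrow> 'a \<Rightarrow> 'a \<Rightarrow> 'a \<Rightarrow> bool" where
  "unique_middle V E a b d \<longleftrightarrow> a \<in> V \<and> b \<in> V \<and> d \<in> V \<and> a \<noteq> d \<and> {a, b} \<in> E \<and> {b, d} \<in> E \<and>
     (\<forall>x\<in>V. {a, x} \<in> E \<longrightarrow> {x, d} \<in> E \<longrightarrow> x = b)"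

text \<open>A chain along one geodesic, described by the graph alone so that automorphisms preserve
  it. For \<open>n = k\<close> it will express orthogonality.\<close>

definition straight :: "'a set \<Rightarrow> 'a set set \<Rightarrow> nat \<Rightarrow> 'a \<Rightarrow> 'a \<Rightarrow> bool" where
  "straight V E n a d \<longleftrightarrow> (\<exists>x. x 0 = a \<and> x n = d \<and>
     (\<forall>i. i + 2 \<le> n \<longrightarrow> unique_middle V E (x i) (x (i + 1)) (x (i + 2))))"

lemma aut_group_iff:
  "\<phi> \<in> carrier (aut_group V E) \<longleftrightarrow> \<phi> \<in> extensional V \<and> bij_betw \<phi> V V \<and>
     (\<forall>u\<in>V. \<forall>v\<in>V. {u, v} \<in> E \<longleftrightarrow> {\<phi> u, \<phi> v} \<in> E)"
  by (auto simp: aut_group_def Bij_def)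

lemma unique_middle_aut:
  assumes "\<phi> \<in> carrier (aut_group V E)" "a \<in> V" "b \<in> V" "d \<in> V"
  shows "unique_middle V E (\<phi> a) (\<phi> b) (\<phi> d) \<longleftrightarrow> unique_middle V E a b d"
proof -
  have \<phi>: "inj_on \<phi> V" "\<phi> ` V = V" and E: "\<And>u v. u \<in> V \<Longrightarrow> v \<in> V \<Longrightarrow> {\<phi> u, \<phi> v} \<in> E \<longleftrightarrow> {u, v} \<in> E"
    using assms(1) by (auto simp: aut_group_iff bij_betw_def)
  have inj: "\<And>u v. u \<in> V \<Longrightarrow> v \<in> V \<Longrightarrow> \<phi> u = \<phi> v \<longleftrightarrow> u = v"
    using \<phi>(1) by (simp add: inj_on_eq_iff)
  have "(\<forall>x\<in>V. {\<phi> a, x} \<in> E \<longrightarrow> {x, \<phi> d} \<in> E \<longrightarrow> x = \<phi> b) \<longleftrightarrow>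
      (\<forall>x\<in>V. {\<phi> a, \<phi> x} \<in> E \<longrightarrow> {\<phi> x, \<phi> d} \<in> E \<longrightarrow> \<phi> x = \<phi> b)"
    by (subst (1) \<phi>(2) [symmetric]) (rule ball_simps)
  also have "\<dots> \<longleftrightarrow> (\<forall>x\<in>V. {a, x} \<in> E \<longrightarrow> {x, d} \<in> E \<longrightarrow> x = b)"
    using assms(2-4) by (intro ball_cong refl) (simp only: E inj)
  finally have "(\<forall>x\<in>V. {\<phi> a, x} \<in> E \<longrightarrow> {x, \<phi> d} \<in> E \<longrightarrow> x = \<phi> b) \<longleftrightarrow>
      (\<forall>x\<in>V. {a, x} \<in> E \<longrightarrow> {x, d} \<in> E \<longrightarrow> x = b)" .
  moreover have "\<phi> a \<in> V" "\<phi> b \<in> V" "\<phi> d \<in> V"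
    using assms(2-4) \<phi>(2) by blast+
  ultimately show ?thesis
    using assms(2-4) by (simp only: unique_middle_def E inj)
qed

text \<open>As \<open>n\<close> is at least 2, every index up to \<open>n\<close> occurs in some
  triple, which places the chain in \<open>V\<close>. It can then be pushed forward by
  \<open>\<phi>\<close> and pulled back by the inverse.\<close>

lemma straight_aut:
  assumes \<phi>: "\<phi> \<in> carrier (aut_group V E)" and "a \<in> V" "d \<in> V" and n: "2 \<le> n"
  shows "straight V E n (\<phi> a) (\<phi> d) \<longleftrightarrow> straight V E n a d"
proof
  have in_V: "x i \<in> V" if "\<forall>i. i + 2 \<le> n \<longrightarrow> unique_middle V E (x i) (x (i + 1)) (x (i + 2))" "i \<le> n"
    for x i
  proof (cases "i + 2 \<le> n")
    case True
    with that show ?thesis by (auto simp: unique_middle_def)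
  next
    case False
    then have "i = (n - 2) + 1 \<or> i = (n - 2) + 2" using that(2) n by arith
    moreover have "unique_middle V E (x (n - 2)) (x (n - 2 + 1)) (x (n - 2 + 2))"
      using that(1) n by simp
    ultimately show ?thesis by (auto simp: unique_middle_def)
  qed
  {
    assume "straight V E n a d"
    then obtain x where x: "x 0 = a" "x n = d"
      and um: "\<forall>i. i + 2 \<le> n \<longrightarrow> unique_middle V E (x i) (x (i + 1)) (x (i + 2))"
      by (auto simp: straight_def)
    then show "straight V E n (\<phi> a) (\<phi> d)"
      unfolding straight_def using in_V [OF um] unique_middle_aut [OF \<phi>]
      by (intro exI [of _ "\<phi> \<circ> x"]) auto
  }
  {
    have bij: "bij_betw \<phi> V V" using \<phi> by (simp add: aut_group_iff)
    assume "straight V E n (\<phi> a) (\<phi> d)"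
    then obtain x where x: "x 0 = \<phi> a" "x n = \<phi> d"
      and um: "\<forall>i. i + 2 \<le> n \<longrightarrow> unique_middle V E (x i) (x (i + 1)) (x (i + 2))"
      by (auto simp: straight_def)
    define y where "y i = inv_into V \<phi> (x i)" for i
    have y: "y i \<in> V" "\<phi> (y i) = x i" if "i \<le> n" for i
      using in_V [OF um that] bij by (auto simp: y_def bij_betw_def inv_into_into f_inv_into_f)
    have "unique_middle V E (y i) (y (i + 1)) (y (i + 2))" if "i + 2 \<le> n" for i
      using that um y unique_middle_aut [OF \<phi>, of "y i" "y (i + 1)" "y (i + 2)"] by simp
    moreover have "y 0 = a" "y n = d"
      using bij assms(2,3) by (simp_all add: y_def x bij_betw_def)
    ultimately show "straight V E n a d"
      by (auto simp: straight_def)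
  }
qed

subsection \<open>The projective plane as a graph\<close>

text \<open>The least code among the nonzero multiples of \<open>v\<close> is a canonical name for
  its line. Parallel vectors thus become equal natural numbers, and the vertices form a set of type
  \<open>nat set\<close>.\<close>

definition point :: "'a::{field, countable} ^ 'n \<Rightarrow> nat" where
  "point v = (LEAST n. \<exists>t. t \<noteq> 0 \<and> n = to_nat (t *s v))"

lemma point_eq_iff: "point u = point v \<longleftrightarrow> parallel u v"
proof
  have ex: "\<exists>t. t \<noteq> 0 \<and> point v = to_nat (t *s v)" for v :: "'a ^ 'n"
    unfolding point_def by (rule LeastI_ex) (use one_neq_zero in blast)
  assume "point u = point v"
  then obtain s t where "s \<noteq> 0" "t \<noteq> 0" "to_nat (s *s u) = to_nat (t *s v)"
    using ex [of u] ex [of v] by auto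
  then have "s *s u = t *s v" by simp
  then show "parallel u v"
    using parallel_scale [OF \<open>s \<noteq> 0\<close>, of u] parallel_scale [OF \<open>t \<noteq> 0\<close>, of v]
      parallel_sym parallel_trans by metis
next
  assume "parallel u v"
  then obtain r where r: "r \<noteq> 0" "v = r *s u" by (auto simp: parallel_def)
  have "(\<exists>t. t \<noteq> 0 \<and> n = to_nat (t *s u)) \<longleftrightarrow> (\<exists>t. t \<noteq> 0 \<and> n = to_nat (t *s v))" for n
  proof
    assume "\<exists>t. t \<noteq> 0 \<and> n = to_nat (t *s u)"
    then obtain t where "t \<noteq> 0" "n = to_nat (t *s u)" by blast
    then show "\<exists>t. t \<noteq> 0 \<and> n = to_nat (t *s v)"
      using r by (intro exI [of _ "t / r"]) (simp add: vector_smult_assoc)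
  next
    assume "\<exists>t. t \<noteq> 0 \<and> n = to_nat (t *s v)"
    then obtain t where "t \<noteq> 0" "n = to_nat (t *s v)" by blast
    then show "\<exists>t. t \<noteq> 0 \<and> n = to_nat (t *s u)"
      using r by (intro exI [of _ "t * r"]) (simp add: vector_smult_assoc)
  qed
  then show "point u = point v" by (simp add: point_def)
qed

type_synonym vec3 = "elem_real ^ 3"

definition points :: "nat set" where
  "points = {point v | v :: vec3. v \<noteq> 0}"

text \<open>The homogeneous form, up to sign, of the cosine of the enclosed angle being
  \<open>c\<close>; it depends neither on the length nor on the sign of the representatives.\<close>

definition adjacent :: "elem_real \<Rightarrow> vec3 \<Rightarrow> vec3 \<Rightarrow> bool" where
  "adjacent c u v \<longleftrightarrow> (dot u v)\<^sup>2 = c\<^sup>2 * (dot u u * dot v v)"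

definition edges :: "elem_real \<Rightarrow> nat set set" where
  "edges c = {{point u, point v} | u v. u \<noteq> 0 \<and> v \<noteq> 0 \<and> adjacent c u v}"

lemma adjacent_sym: "adjacent c u v \<longleftrightarrow> adjacent c v u"
  by (simp add: adjacent_def dot_commute mult.commute)

lemma adjacent_parallel:
  assumes "parallel u u'" "adjacent c u v"
  shows "adjacent c u' v"
proof -
  obtain t where "u' = t *s u" using assms(1) by (auto simp: parallel_def)
  then have "(dot u' v)\<^sup>2 = t\<^sup>2 * (dot u v)\<^sup>2" "dot u' u' = t\<^sup>2 * dot u u"
    by (simp_all add: power_mult_distrib power2_eq_square)
  then show ?thesis using assms(2) by (simp add: adjacent_def)
qed

lemma edges_iff:
  assumes "u \<noteq> 0" "v \<noteq> 0"
  shows "{point u, point v} \<in> edges c \<longleftrightarrow> adjacent c u v"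
proof
  assume "{point u, point v} \<in> edges c"
  then obtain u' v' where "{point u, point v} = {point u', point v'}" and a: "adjacent c u' v'"
    by (auto simp: edges_def)
  then consider "parallel u' u" "parallel v' v" | "parallel u' v" "parallel v' u"
    by (auto simp: doubleton_eq_iff point_eq_iff parallel_sym)
  then show "adjacent c u v"
    by cases (metis a adjacent_parallel adjacent_sym)+
qed (use assms in \<open>auto simp: edges_def\<close>)

lemma point_in_points [simp]: "point (v :: vec3) \<in> points \<longleftrightarrow> v \<noteq> 0"
proof
  assume "point v \<in> points"
  then obtain w :: vec3 where "w \<noteq> 0" "parallel w v"
    by (auto simp: points_def point_eq_iff parallel_sym)
  then show "v \<noteq> 0" by (auto simp: parallel_def)
qed (auto simp: points_def)

lemma unit_representative:
  assumes "x \<in> points"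
  obtains u :: vec3 where "dot u u = 1" "point u = x"
proof -
  obtain v :: vec3 where v: "v \<noteq> 0" "x = point v" using assms by (auto simp: points_def)
  obtain u where "parallel v u" "dot u u = 1"
    using unit_multiple_exists [OF elem_real_sqrt_ex v(1)] by blast
  then show ?thesis
    using that v(2) by (metis point_eq_iff)
qed

lemma unit_nonzero: "dot u u = 1 \<Longrightarrow> u \<noteq> (0 :: vec3)"
  by (metis dot_self_eq_0_iff zero_neq_one)

lemma point_minus [simp]: "point (- v :: vec3) = point v"
proof -
  have "parallel v (- v)"
    unfolding parallel_def by (rule exI [of _ "- 1"]) (simp add: vec_eq_iff)
  then show ?thesis
    unfolding point_eq_iff by (rule parallel_sym)
qed

lemma adjacent_unit:
  assumes "dot u u = 1" "dot v v = 1"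
  shows "adjacent c u v \<longleftrightarrow> dot u v = c \<or> dot u v = - c"
  using assms by (simp add: adjacent_def power2_eq_iff)

lemma neighbour_representative:
  fixes u :: vec3
  assumes "dot u u = 1" "x \<in> points" "{point u, x} \<in> edges c"
  obtains v :: vec3 where "dot v v = 1" "point v = x" "dot u v = c"
proof -
  obtain v :: vec3 where v: "dot v v = 1" "point v = x"
    using unit_representative [OF assms(2)] .
  have "adjacent c u v"
  proof -
    have "u \<noteq> 0" "v \<noteq> 0" using unit_nonzero assms(1) v(1) by blast+
    then show ?thesis using edges_iff [of u v c] assms(3) v(2) by simp
  qed
  then have "dot u v = c \<or> dot u v = - c"
    using adjacent_unit assms(1) v(1) by blast
  then show ?thesis
    using that [of v] that [of "- v"] v by (elim disjE) simp_all
qed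

text \<open>A vector adjacent to a parallel one would give \<open>c\<^sup>2 = 1\<close>, so there
  are no loops.\<close>

lemma is_graph_points:
  assumes "c\<^sup>2 < 1"
  shows "is_graph points (edges c)"
  unfolding is_graph_def
proof
  fix e assume "e \<in> edges c"
  then obtain u v :: vec3 where uv: "u \<noteq> 0" "v \<noteq> 0" "adjacent c u v" "e = {point u, point v}"
    by (auto simp: edges_def)
  have "point u \<noteq> point v"
  proof
    assume "point u = point v"
    then have "(dot u v)\<^sup>2 = dot u u * dot v v"
      using uv by (simp add: point_eq_iff dot_square_eq_iff_parallel)
    with uv have "c\<^sup>2 = 1" by (simp add: adjacent_def)
    with assms show False by simp
  qed
  with uv(1,2,4) show "e \<subseteq> points \<and> card e = 2" by simp
qed

lemma infinite_points: "infinite points"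
proof -
  let ?f = "\<lambda>n :: nat. point (vector [1, of_nat n, 0] :: vec3)"
  have "inj ?f"
  proof
    fix m n assume "?f m = ?f n"
    then show "m = n"
      by (auto simp: point_eq_iff parallel_def vec_eq_iff forall_3)
  qed
  moreover have "range ?f \<subseteq> points"
    by (auto simp: vec_eq_iff forall_3)
  ultimately show ?thesis
    using finite_subset range_inj_infinite by blast
qed

section \<open>Symmetries of the graph and their fixed points\<close>

text \<open>For distinct unit vectors, the reflection in the plane orthogonal to
  \<open>a - b\<close> interchanges them.\<close>

lemma reflection_exists:
  assumes units: "dot a a = 1" "dot b b = (1 :: elem_real)"
  shows "\<exists>R :: vec3 \<Rightarrow> vec3. R a = b \<and> (\<forall>v. R (R v) = v) \<and> (\<forall>u v. dot (R u) (R v) = dot u v) \<and>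
           (\<forall>t v. R (t *s v) = t *s R v)"
proof (cases "a = b")
  case True
  then show ?thesis by (intro exI [of _ id]) simp
next
  case False
  define d where "d = a - b"
  have dd: "dot d d \<noteq> 0"
    unfolding dot_self_eq_0_iff using False by (simp add: d_def)
  define R where "R v = v - (2 * dot v d / dot d d) *s d" for v
  have Rd: "dot (R v) d = - dot v d" for v
    using dd by (simp add: R_def)
  \<comment> \<open>This makes the quotient in \<open>R a\<close> equal to 1, so that
    \<open>R a = a - d\<close>.\<close>
  have "dot d d = 2 * dot a d"
    using units by (simp add: d_def dot_commute [of b a])
  then have "R a = b"
    using dd by (simp add: R_def) (simp add: d_def)
  moreover have "R (R v) = v" for v
    by (simp add: R_def [of "R v"] Rd) (simp add: R_def vec_eq_iff)
  moreover have "dot (R u) (R v) = dot u v" for u v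
  proof -
    have "dot (R u) (R v) = dot (R u) v - (2 * dot v d / dot d d) * dot (R u) d"
      by (subst (2) R_def) simp
    also have "\<dots> = dot u v"
      using dd unfolding Rd by (simp add: R_def dot_commute [of d v])
    finally show ?thesis .
  qed
  moreover have "R (t *s v) = t *s R v" for t v
    by (simp add: R_def vec_eq_iff algebra_simps)
  ultimately show ?thesis by blast
qed

lemma aut_group_points_transitive: "transitive_action (aut_group points (edges c)) points (\<lambda>\<phi>. \<phi>)"
proof -
  have "\<exists>\<phi>\<in>carrier (aut_group points (edges c)). \<phi> x = y" if "x \<in> points" "y \<in> points" for x y
  proof -
    obtain a :: vec3 where a: "dot a a = 1" "point a = x"
      using unit_representative [OF \<open>x \<in> points\<close>] .
    obtain b :: vec3 where b: "dot b b = 1" "point b = y"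
      using unit_representative [OF \<open>y \<in> points\<close>] .
    obtain R :: "vec3 \<Rightarrow> vec3" where R: "R a = b" "\<And>v. R (R v) = v"
      "\<And>u v. dot (R u) (R v) = dot u v" "\<And>t v. R (t *s v) = t *s R v"
      using reflection_exists [OF a(1) b(1)] by blast
    have R_nz: "R v \<noteq> 0" if "v \<noteq> 0" for v
      using that R(3) by (metis dot_self_eq_0_iff)
    have R_par: "parallel (R u) (R v)" if "parallel u v" for u v
      using that by (auto simp: parallel_def R(4))
    \<comment> \<open>Every representative gives the same value, since \<open>R\<close> sends
      parallel vectors to parallel vectors.\<close>
    define \<phi> where "\<phi> = (\<lambda>x\<in>points. point (R (SOME v. point v = x)))"
    have \<phi>: "\<phi> (point v) = point (R v)" if "v \<noteq> 0" for v
    proof -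
      have "parallel v (SOME w. point w = point v)"
        using someI [of "\<lambda>w. point w = point v" v] by (simp add: point_eq_iff parallel_sym)
      with that R_par show ?thesis by (simp add: \<phi>_def point_eq_iff parallel_sym)
    qed
    have \<phi>_points: "\<phi> z \<in> points" "\<phi> (\<phi> z) = z" if z: "z \<in> points" for z
    proof -
      obtain v :: vec3 where v: "v \<noteq> 0" "z = point v"
        using z unfolding points_def by blast
      show "\<phi> z \<in> points" "\<phi> (\<phi> z) = z"
        by (simp_all add: v \<phi> R_nz R(2))
    qed
    then have "bij_betw \<phi> points points"
      by (intro bij_betw_byWitness [where f' = \<phi>]) blast+
    moreover have "{u, v} \<in> edges c \<longleftrightarrow> {\<phi> u, \<phi> v} \<in> edges c" if uv: "u \<in> points" "v \<in> points" for u v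
    proof -
      obtain u' v' :: vec3 where "u' \<noteq> 0" "u = point u'" "v' \<noteq> 0" "v = point v'"
        using uv unfolding points_def by blast
      then show ?thesis
        by (simp add: \<phi> R_nz edges_iff adjacent_def R(3))
    qed
    moreover have "\<phi> \<in> extensional points" by (simp add: \<phi>_def)
    ultimately have "\<phi> \<in> carrier (aut_group points (edges c))" by (simp add: aut_group_iff)
    moreover have "\<phi> x = y"
      using \<phi> [OF unit_nonzero [OF a(1)]] by (simp add: a b R)
    ultimately show ?thesis by blast
  qed
  then show ?thesis
    by (simp add: transitive_action_def transitive_action_axioms_def group_action_aut_group)
qed

text \<open>An automorphism preserving orthogonality lifts to a map of vectors that agrees, up to
  scaling, with an orthogonal matrix; a line fixed by this matrix is a fixed vertex.\<close>

lemma strongly_rotarily_transitive_points: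
  assumes orth: "\<And>\<phi> (u :: vec3) v (u' :: vec3) v'. \<phi> \<in> carrier (aut_group points (edges c)) \<Longrightarrow>
      u \<noteq> 0 \<Longrightarrow> v \<noteq> 0 \<Longrightarrow> u' \<noteq> 0 \<Longrightarrow> v' \<noteq> 0 \<Longrightarrow> point u' = \<phi> (point u) \<Longrightarrow> point v' = \<phi> (point v) \<Longrightarrow>
      dot u' v' = 0 \<longleftrightarrow> dot u v = 0"
  shows "strongly_rotarily_transitive points (edges c)"
  unfolding strongly_rotarily_transitive_def
proof (intro conjI ballI aut_group_points_transitive)
  fix \<phi> assume \<phi>: "\<phi> \<in> carrier (aut_group points (edges c))"
  have "\<exists>w :: vec3. w \<noteq> 0 \<and> point w = \<phi> (point v)" if "v \<noteq> 0" for v :: vec3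
  proof -
    have "\<phi> (point v) \<in> points"
      using \<phi> that by (auto simp: aut_group_iff bij_betw_def)
    then show ?thesis unfolding points_def by fastforce
  qed
  then obtain \<Phi> :: "vec3 \<Rightarrow> vec3" where \<Phi>: "\<And>v. v \<noteq> 0 \<Longrightarrow> \<Phi> v \<noteq> 0"
    "\<And>v. v \<noteq> 0 \<Longrightarrow> point (\<Phi> v) = \<phi> (point v)"
    by metis
  have "\<exists>M. orthogonal_matrix M \<and> (\<forall>v. v \<noteq> 0 \<longrightarrow> parallel (M *v v) (\<Phi> v))"
  proof (rule orthogonality_preserving_imp_orthogonal_matrix)
    show "dot (\<Phi> u) (\<Phi> v) = 0 \<longleftrightarrow> dot u v = 0" if "u \<noteq> 0" "v \<noteq> 0" for u v
      using orth [OF \<phi> that] \<Phi> that by simp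
  qed (simp_all add: elem_real_sqrt_ex \<Phi>)
  then obtain M where M: "orthogonal_matrix M" "\<And>v. v \<noteq> 0 \<Longrightarrow> parallel (M *v v) (\<Phi> v)"
    by blast
  obtain v where v: "v \<noteq> 0" "parallel v (M *v v)"
    using orthogonal_matrix_fixes_line [OF M(1)] by blast
  have "\<phi> (point v) = point v"
    using \<Phi>(2) [OF v(1)] M(2) [OF v(1)] v(2) by (metis point_eq_iff)
  moreover have "point v \<in> points" using v(1) by simp
  ultimately show "\<exists>x\<in>points. \<phi> x = x" ..
qed

section \<open>Short paths and the choice of representatives\<close>

lemma adjacent_0_iff [simp]: "adjacent 0 u v \<longleftrightarrow> dot u v = 0"
  by (simp add: adjacent_def)

text \<open>The bound \<open>2 * c\<^sup>2 - 1\<close> is the cosine of the doubled angle, so the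
  apex of an isosceles triangle joins the two points. Coinciding points, where this construction
  degenerates, are joined by the path of length 0.\<close>

lemma two_step_path:
  fixes u v :: vec3
  assumes units: "dot u u = 1" "dot v v = 1" and uv: "0 \<le> dot u v" "2 * c\<^sup>2 - 1 \<le> dot u v"
  shows "\<exists>vs. path_connects points (edges c) vs (point u) (point v) \<and> path_length vs \<le> 2"
proof -
  have nz: "u \<noteq> 0" "v \<noteq> 0"
    using units unit_nonzero by blast+
  have "(dot u v)\<^sup>2 \<le> 1"
    using dot_Cauchy_Schwarz [of u v] units by simp
  then have "dot u v \<le> 1"
    using uv(1) by (simp add: abs_square_le_1)
  then consider "dot u v = 1" | "dot u v < 1" by linarith
  then show ?thesis
  proof cases
    case 1
    then have "parallel u v"
      using nz units by (simp flip: dot_square_eq_iff_parallel)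
    then have "point u = point v" by (simp add: point_eq_iff)
    then have "path_connects points (edges c) [point u] (point u) (point v)"
      using path_connects_singleton nz by (metis point_in_points)
    moreover have "path_length [point u] \<le> 2" by (simp add: path_length_def)
    ultimately show ?thesis by blast
  next
    case 2
    obtain w where w: "dot w w = 1" "dot u w = c" "dot w v = c"
      using isosceles_apex_exists [OF elem_real_sqrt_ex units uv(1) 2 uv(2)] by blast
    have "w \<noteq> 0" using w(1) by (rule unit_nonzero)
    have e: "{point u, point w} \<in> edges c" "{point w, point v} \<in> edges c"
      using w units nz \<open>w \<noteq> 0\<close> by (simp_all add: edges_iff adjacent_unit)
    have pts: "point u \<in> points" "point w \<in> points" "point v \<in> points"
      using nz \<open>w \<noteq> 0\<close> by simp_all
    note p1 = path_connects_Cons [OF path_connects_singleton [OF pts(3)] pts(2) e(2)]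
    note p2 = path_connects_Cons [OF p1(1) pts(1) e(1)]
    have "path_length [point u, point w, point v] \<le> 2" by (simp add: path_length_def)
    with p2(1) show ?thesis by blast
  qed
qed

text \<open>Replacing one vector by its negative makes the enclosed angle at most a right
  angle.\<close>

lemma points_pair_representatives:
  assumes "x \<in> points" "y \<in> points"
  obtains u v :: vec3 where "dot u u = 1" "dot v v = 1" "point u = x" "point v = y" "0 \<le> dot u v"
proof -
  obtain u :: vec3 where u: "dot u u = 1" "point u = x"
    using unit_representative [OF assms(1)] .
  obtain v :: vec3 where v: "dot v v = 1" "point v = y"
    using unit_representative [OF assms(2)] .
  have "0 \<le> dot u v \<or> 0 \<le> dot u (- v)"
    by (simp add: linear)
  then show ?thesis
    using that [of u v] that [of u "- v"] u v by (elim disjE) simp_all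
qed

lemma graph_connectedI:
  assumes "\<And>u v. u \<in> V \<Longrightarrow> v \<in> V \<Longrightarrow> \<exists>vs. path_connects V E vs u v \<and> path_length vs \<le> k"
  shows "graph_connected V E"
  using assms unfolding graph_connected_def by blast

section \<open>The graph of the angle \<pi> / 2k for k at least 3: orthogonality\<close>

context angle_subdivision
begin

lemma C_1_pos: "0 < C 1"
  using C_pos k by simp

lemma C_1_S_1: "(C 1)\<^sup>2 = 1 - (S 1)\<^sup>2"
  using unit [of 1] by (simp add: algebra_simps)

lemma C_2: "C 2 = 2 * (C 1)\<^sup>2 - 1"
  using C_Suc [of 1] C_1_S_1 by (simp add: numeral_2_eq_2 power2_eq_square)

text \<open>For \<open>k\<close> at least 3 the doubled angle is still below \<pi> / 2, so
  \<open>C 2\<close> is positive. This is what makes middles unique.\<close>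

lemma C_1_square: "(C 1)\<^sup>2 < 1" "1 < 2 * (C 1)\<^sup>2"
  using C_1_S_1 S_1 C_pos [of 2] k C_2 by simp_all

lemma C_eq: "C n = C (Suc n) * C 1 + S (Suc n) * S 1"
  using C_Suc [of n] S_Suc [of n] unit [of 1] by algebra

text \<open>The Chebyshev recurrence for cosines, matching the relation
  \<open>d = (2 * C 1) *s b - a\<close> between consecutive vectors on a geodesic.\<close>

lemma C_Suc_Suc: "C (Suc (Suc n)) = 2 * C 1 * C (Suc n) - C n"
  using C_Suc [of "Suc n"] C_eq [of n] by algebra

text \<open>By \<open>common_neighbour_unique\<close> every common neighbour lies on the bisecting
  line of \<open>u + v\<close>.\<close>

lemma unique_middle_points:
  fixes u v w :: vec3
  assumes units: "dot u u = 1" "dot w w = 1" "dot v v = 1"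
    and dots: "dot u w = C 1" "dot w v = C 1" "dot u v = 2 * (C 1)\<^sup>2 - 1"
  shows "unique_middle points (edges (C 1)) (point u) (point w) (point v)"
proof -
  have nz: "u \<noteq> 0" "w \<noteq> 0" "v \<noteq> 0"
    using units unit_nonzero by blast+
  have "point u \<noteq> point v"
  proof
    assume "point u = point v"
    then have "parallel u v" by (simp add: point_eq_iff)
    then have "(dot u v)\<^sup>2 = 1"
      using nz units by (simp flip: dot_square_eq_iff_parallel)
    then have "dot u v = 1 \<or> dot u v = - 1"
      by (simp add: power2_eq_1_iff)
    with dots C_1_square show False by auto
  qed
  moreover have "{point u, point w} \<in> edges (C 1)" "{point w, point v} \<in> edges (C 1)"
    using nz units dots by (simp_all add: edges_iff adjacent_unit)
  moreover have "x = point w"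
    if x: "x \<in> points" "{point u, x} \<in> edges (C 1)" "{x, point v} \<in> edges (C 1)" for x
  proof -
    obtain y :: vec3 where y: "dot y y = 1" "point y = x"
      using unit_representative [OF x(1)] .
    have "y \<noteq> 0" using y(1) by (rule unit_nonzero)
    have "adjacent (C 1) u y" "adjacent (C 1) y v"
      using x(2,3) edges_iff [OF nz(1) \<open>y \<noteq> 0\<close>] edges_iff [OF \<open>y \<noteq> 0\<close> nz(3)]
      by (simp_all add: y(2))
    then have "(dot u y)\<^sup>2 = (C 1)\<^sup>2" "(dot y v)\<^sup>2 = (C 1)\<^sup>2"
      using units y(1) by (simp_all add: adjacent_def)
    then have "parallel (u + v) y"
      using common_neighbour_unique [OF units(1,3) y(1) dots(3) C_1_square(2)] by simp
    moreover have "parallel (u + v) w"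
      using common_neighbour_unique [OF units(1,3,2) dots(3) C_1_square(2)] dots by simp
    ultimately have "parallel y w"
      using parallel_sym parallel_trans by blast
    with y(2) show ?thesis by (simp flip: point_eq_iff)
  qed
  ultimately show ?thesis
    using nz by (simp add: unique_middle_def)
qed

text \<open>The chain runs along the great circle from \<open>a\<close> to \<open>b\<close> in steps
  of \<theta>. Vectors two steps apart enclose 2\<theta>, which gives unique middles, and
  \<open>C k = 0\<close> puts the last one on the line of \<open>b\<close>.\<close>

lemma straight_if_orthogonal:
  fixes u v :: vec3
  assumes uv: "u \<noteq> 0" "v \<noteq> 0" "dot u v = 0"
  shows "straight points (edges (C 1)) k (point u) (point v)"
proof -
  obtain a where a: "parallel u a" "dot a a = 1"
    using unit_multiple_exists [OF elem_real_sqrt_ex uv(1)] by blast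
  obtain b where b: "parallel v b" "dot b b = 1"
    using unit_multiple_exists [OF elem_real_sqrt_ex uv(2)] by blast
  have ab: "dot a b = 0" "dot b a = 0"
    using dot_eq_0_parallel_cong [OF a(1) b(1)] uv(3) by (simp_all add: dot_commute [of b a])
  define x where "x n = C n *s a + S n *s b" for n
  have dot_x: "dot (x m) (x n) = C m * C n + S m * S n" for m n
    by (simp add: x_def ab a b)
  have x0: "dot (x n) (x n) = 1" for n
    using unit [of n] by (simp add: dot_x power2_eq_square)
  have x1: "dot (x n) (x (Suc n)) = C 1" for n
    unfolding dot_x using unit [of n] C_Suc [of n] S_Suc [of n] by algebra
  have x2: "dot (x n) (x (Suc (Suc n))) = 2 * (C 1)\<^sup>2 - 1" for n
    unfolding dot_x C_Suc_Suc [of n] S_Suc [of "Suc n"]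
    using unit [of n] unit [of 1] C_Suc [of n] S_Suc [of n] by algebra
  have um: "unique_middle points (edges (C 1)) (point (x n)) (point (x (n + 1))) (point (x (n + 2)))" for n
    using unique_middle_points [OF x0 x0 x0 x1 x1 x2, of n] by simp
  have "x 0 = a" by (simp add: x_def)
  have "S k *s b = x k" by (simp add: x_def C_k)
  moreover have "S k \<noteq> 0" using unit [of k] by (auto simp: C_k)
  ultimately have "parallel b (x k)" by (metis parallel_scale)
  then have "point (x k) = point v"
    unfolding point_eq_iff using b(1) parallel_sym parallel_trans by blast
  moreover have "point (x 0) = point u"
    unfolding \<open>x 0 = a\<close> point_eq_iff using a(1) by (rule parallel_sym)
  ultimately show ?thesis
    unfolding straight_def using um by (intro exI [of _ "\<lambda>n. point (x n)"]) simp
qed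

text \<open>Each unique middle determines the next vector by reflection. The products with the
  starting vector therefore obey the recurrence of \<open>C\<close>, and the last one is
  \<open>C k = 0\<close>.\<close>

lemma orthogonal_if_straight:
  fixes u v :: vec3
  assumes uv: "u \<noteq> 0" "v \<noteq> 0" and str: "straight points (edges (C 1)) k (point u) (point v)"
  shows "dot u v = 0"
proof -
  obtain x where x: "x 0 = point u" "x k = point v"
    and um: "\<And>i. i + 2 \<le> k \<Longrightarrow> unique_middle points (edges (C 1)) (x i) (x (i + 1)) (x (i + 2))"
    using str unfolding straight_def by blast
  obtain e :: vec3 where e: "dot e e = 1" "point e = point u"
    using unit_representative uv(1) by (metis point_in_points)
  \<comment> \<open>Two consecutive representatives are carried along because the recurrence has
    order two; their signs are chosen so that neighbours have product \<open>C 1\<close>.\<close>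
  have "\<exists>a b. dot a a = 1 \<and> dot b b = 1 \<and> dot a b = C 1 \<and> point a = x n \<and> point b = x (Suc n) \<and>
          dot e a = C n \<and> dot e b = C (Suc n)" if "Suc n \<le> k" for n
    using that
  proof (induction n)
    case 0
    have "x 1 \<in> points" "{point e, x 1} \<in> edges (C 1)"
      using um [of 0] k x(1) e(2) by (simp_all add: unique_middle_def)
    then obtain b where b: "dot b b = 1" "point b = x 1" "dot e b = C 1"
      using neighbour_representative [OF e(1)] by metis
    then show ?case
      using e x(1) by (intro exI [of _ e] exI [of _ b]) simp
  next
    case (Suc n)
    then obtain a b where ab: "dot a a = 1" "dot b b = 1" "dot a b = C 1"
      "point a = x n" "point b = x (Suc n)" "dot e a = C n" "dot e b = C (Suc n)"
      by auto
    have nz: "a \<noteq> 0" "b \<noteq> 0"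
      using ab(1,2) unit_nonzero by blast+
    have m: "x (Suc (Suc n)) \<in> points" "x n \<noteq> x (Suc (Suc n))"
      "{x (Suc n), x (Suc (Suc n))} \<in> edges (C 1)"
      "\<And>y. y \<in> points \<Longrightarrow> {x n, y} \<in> edges (C 1) \<Longrightarrow> {y, x (Suc (Suc n))} \<in> edges (C 1) \<Longrightarrow>
        y = x (Suc n)"
      using um [of n] Suc.prems by (simp_all add: unique_middle_def)
    have "{point b, x (Suc (Suc n))} \<in> edges (C 1)" using m(3) ab(5) by simp
    then obtain d where d: "dot d d = 1" "point d = x (Suc (Suc n))" "dot b d = C 1"
      using neighbour_representative [OF ab(2) m(1)] by metis
    have "d \<noteq> 0" using d(1) by (rule unit_nonzero)
    have "d = (2 * C 1) *s b - a"
    proof (rule reflection_to_common_neighbour [OF ab(1) d(1) ab(2,3) d(3)])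
      show "C 1 \<noteq> 0" using C_1_pos by simp
      show "\<not> parallel a d" using m(2) ab(4) d(2) by (metis point_eq_iff)
      fix y assume y: "dot y y = 1" "dot a y = C 1" "dot y d = C 1"
      have "y \<noteq> 0" using y(1) by (rule unit_nonzero)
      have "{point a, point y} \<in> edges (C 1)" "{point y, point d} \<in> edges (C 1)"
        unfolding edges_iff [OF nz(1) \<open>y \<noteq> 0\<close>] edges_iff [OF \<open>y \<noteq> 0\<close> \<open>d \<noteq> 0\<close>]
        using y ab(1) d(1) by (simp_all add: adjacent_unit)
      then have "point y = x (Suc n)"
        using m(4) [of "point y"] \<open>y \<noteq> 0\<close> ab(4) d(2) by simp
      then show "parallel b y"
        using ab(5) by (simp flip: point_eq_iff)
    qed
    then have "dot e d = C (Suc (Suc n))"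
      using C_Suc_Suc [of n] ab by simp
    then show ?case
      using ab d by (intro exI [of _ b] exI [of _ d]) simp
  qed
  \<comment> \<open>At \<open>n = k - 1\<close> the second vector of the pair represents
    \<open>x k\<close>.\<close>
  from this [of "k - 1"] obtain b where b: "point b = x k" "dot e b = 0"
    using k C_k by auto
  have "parallel e u" "parallel b v"
    using e(2) b(1) x(2) by (simp_all flip: point_eq_iff)
  then show ?thesis
    using b(2) dot_eq_0_parallel_cong by blast
qed

lemma strongly_rotarily_transitive_C_1: "strongly_rotarily_transitive points (edges (C 1))"
proof (rule strongly_rotarily_transitive_points)
  fix \<phi> and u v u' v' :: vec3
  assume \<phi>: "\<phi> \<in> carrier (aut_group points (edges (C 1)))"
    and nz: "u \<noteq> 0" "v \<noteq> 0" "u' \<noteq> 0" "v' \<noteq> 0"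
    and im: "point u' = \<phi> (point u)" "point v' = \<phi> (point v)"
  have orth_iff: "dot a b = 0 \<longleftrightarrow> straight points (edges (C 1)) k (point a) (point b)"
    if "a \<noteq> 0" "b \<noteq> 0" for a b :: vec3
    using straight_if_orthogonal [OF that] orthogonal_if_straight [OF that] by (rule iffI)
  have "straight points (edges (C 1)) k (\<phi> (point u)) (\<phi> (point v)) \<longleftrightarrow>
      straight points (edges (C 1)) k (point u) (point v)"
    using nz k by (intro straight_aut [OF \<phi>]) simp_all
  then show "dot u' v' = 0 \<longleftrightarrow> dot u v = 0"
    using nz by (simp add: orth_iff im)
qed

section \<open>Distances in the graph of the angle \<pi> / 2k\<close>

text \<open>With suitable signs of the representatives each edge turns by \<theta>, so the triangle
  inequality bounds the angle after \<open>i\<close> edges by i\<theta>. As long as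
  \<open>i \<le> k\<close>, the signs needed in \<open>dot_ge_of_two_steps\<close> are
  available.\<close>

lemma path_dot_ge:
  fixes u :: vec3
  assumes u: "dot u u = 1" and p: "path_connects points (edges (C 1)) vs (point u) y"
    and "i < length vs" "i \<le> k"
  shows "\<exists>v. dot v v = 1 \<and> point v = vs ! i \<and> C i \<le> dot u v"
  using assms(3,4)
proof (induction i)
  case 0
  have "vs ! 0 = point u"
    using p hd_conv_nth [of vs] by (simp add: path_connects_def graph_path_def)
  with u show ?case by (intro exI [of _ u]) simp
next
  case (Suc i)
  then obtain v where v: "dot v v = 1" "point v = vs ! i" "C i \<le> dot u v" by auto
  have "vs ! Suc i \<in> points" "{vs ! i, vs ! Suc i} \<in> edges (C 1)"
    using p Suc.prems by (simp_all add: path_connects_def graph_path_def subset_iff)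
  then obtain w where w: "dot w w = 1" "point w = vs ! Suc i" "dot v w = C 1"
    using neighbour_representative [OF v(1)] v(2) by metis
  have "C i * C 1 - S i * S 1 \<le> dot u w"
  proof (rule dot_ge_of_two_steps [OF u w(1) v(1,3)])
    show "0 \<le> C i" "0 \<le> S i" using C_pos [of i] S_nonneg [of i] Suc.prems by simp_all
  qed (use unit [of i] unit [of 1] w(3) C_1_pos S_1 in simp_all)
  then show ?case
    using w C_Suc [of i] by (intro exI [of _ w]) simp
qed

text \<open>This measures a step towards the target: an angle of at most (n + 1)\<theta> drops to at
  most n\<theta>. The comparison is \<open>cos_diff_antimono\<close>, with \<open>C_eq\<close> as
  the difference formula.\<close>

lemma C_le_geodesic_step:
  assumes "n \<le> k" "C (Suc n) \<le> \<sigma>" "0 \<le> \<sigma>" "\<sigma> \<le> C 1" "0 < \<tau>" "\<tau>\<^sup>2 = 1 - \<sigma>\<^sup>2" "0 \<le> S (Suc n)"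
  shows "C n \<le> C 1 * \<sigma> + S 1 * \<tau>"
proof -
  have "C 1 * S (Suc n) - S 1 * C (Suc n) = S n"
    using C_Suc [of n] S_Suc [of n] unit [of 1] by algebra
  then have "0 \<le> C 1 * S (Suc n) - S 1 * C (Suc n)"
    using S_nonneg [OF assms(1)] by (simp only:)
  then show ?thesis
    unfolding C_eq [of n]
    using unit [of 1] less_imp_le [OF S_1] unit [of "Suc n"] assms(7,2-6) by (intro cos_diff_antimono)
qed

text \<open>Steps along the geodesic towards \<open>v\<close> are taken until the remaining angle is
  at most 2\<theta>, where two steps suffice. The induction starts at 2 because a single edge covers
  only the angle \<theta> exactly.\<close>

lemma path_if_dot_ge:
  fixes u v :: vec3
  assumes "2 \<le> n" "n \<le> k" "dot u u = 1" "dot v v = 1" "C n \<le> dot u v" "0 \<le> dot u v"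
  shows "\<exists>vs. path_connects points (edges (C 1)) vs (point u) (point v) \<and> path_length vs \<le> n"
  using assms
proof (induction n arbitrary: u rule: dec_induct)
  case base
  then show ?case
    using two_step_path C_2 by simp
next
  case (step n)
  show ?case
  proof (cases "C 2 \<le> dot u v")
    case True
    then obtain vs where "path_connects points (edges (C 1)) vs (point u) (point v)" "path_length vs \<le> 2"
      using two_step_path [OF step.prems(2,3,5)] C_2 by auto
    with step.hyps show ?thesis by (intro exI [of _ vs]) simp
  next
    case False
    define \<sigma> where "\<sigma> = dot u v"
    have "C 1 < 1"
      using C_1_square(1) C_1_pos by (simp add: abs_square_less_1)
    \<comment> \<open>The remaining angle exceeds 2\<theta> and hence \<theta>, because
      \<open>C 2 \<le> (C 1)\<^sup>2 \<le> C 1\<close>.\<close>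
    then have "(C 1)\<^sup>2 \<le> C 1"
      using C_1_pos mult_left_mono [of "C 1" 1 "C 1"] by (simp add: power2_eq_square)
    then have "\<sigma> \<le> C 1"
      using False C_2 C_1_square(1) unfolding \<sigma>_def by linarith
    then have "\<sigma>\<^sup>2 \<le> (C 1)\<^sup>2"
      using step.prems(5) by (intro power_mono) (simp_all add: \<sigma>_def)
    then have pos: "0 < 1 - \<sigma>\<^sup>2" using C_1_square(1) by simp
    obtain y where y: "y * y = 1 - \<sigma>\<^sup>2"
      using elem_real_sqrt_ex [OF less_imp_le [OF pos]] by blast
    \<comment> \<open>The positive root is the sine of the angle, so the step is directed towards
      \<open>v\<close>.\<close>
    define \<tau> where "\<tau> = \<bar>y\<bar>"
    have \<tau>: "\<tau>\<^sup>2 = 1 - \<sigma>\<^sup>2" "0 < \<tau>"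
      using y pos by (auto simp: \<tau>_def power2_eq_square)
    obtain w where w: "dot w w = 1" "dot u w = C 1" "dot w v = C 1 * \<sigma> + S 1 * \<tau>"
      using geodesic_step_exists [OF step.prems(2,3), of \<tau> "C 1" "S 1"] \<tau> unit [of 1]
      unfolding \<sigma>_def by auto
    have "C n \<le> dot w v"
      unfolding w(3) using step.prems(1,4,5) \<open>\<sigma> \<le> C 1\<close> \<tau> S_nonneg [of "Suc n"]
      by (intro C_le_geodesic_step) (simp_all add: \<sigma>_def)
    moreover have "0 \<le> C n" using C_pos [of n] step.prems(1) by simp
    ultimately obtain vs where vs: "path_connects points (edges (C 1)) vs (point w) (point v)"
      "path_length vs \<le> n"
      using step.IH [OF _ w(1) step.prems(3)] step.prems(1) by auto
    have nz: "u \<noteq> 0" "w \<noteq> 0"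
      using step.prems(2) w(1) unit_nonzero by blast+
    then have "{point u, point w} \<in> edges (C 1)" "point u \<in> points"
      using w step.prems(2) by (simp_all add: edges_iff adjacent_unit)
    from path_connects_Cons [OF vs(1) this(2,1)] vs(2) show ?thesis
      by (intro exI [of _ "point u # vs"]) simp
  qed
qed

lemma path_of_length_le:
  assumes "x \<in> points" "y \<in> points"
  shows "\<exists>vs. path_connects points (edges (C 1)) vs x y \<and> path_length vs \<le> k"
proof -
  obtain u v :: vec3 where "dot u u = 1" "dot v v = 1" "point u = x" "point v = y" "0 \<le> dot u v"
    using points_pair_representatives [OF assms] .
  then show ?thesis
    using path_if_dot_ge [of k u v] k C_k by simp
qed

text \<open>Two coordinate axes enclose \<pi> / 2 = k\<theta>. A path with \<open>n < k\<close>
  edges would end in a vector having product at least \<open>C n > 0\<close> with the first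
  axis.\<close>

lemma graph_diameter_C_1: "graph_diameter points (edges (C 1)) = enat k"
proof (rule graph_diameter_eqI)
  let ?e1 = "axis 1 1 :: vec3" and ?e2 = "axis 2 1 :: vec3"
  show "point ?e1 \<in> points" "point ?e2 \<in> points"
    by (simp_all add: axis_eq_0_iff)
  fix vs assume p: "path_connects points (edges (C 1)) vs (point ?e1) (point ?e2)"
  show "k \<le> path_length vs"
  proof (rule ccontr)
    define n where "n = path_length vs"
    assume "\<not> k \<le> path_length vs"
    then have "n < k" by (simp add: n_def)
    have vs: "vs \<noteq> []" "last vs = point ?e2"
      using p by (auto simp: path_connects_def graph_path_def)
    then have n: "n < length vs" "vs ! n = point ?e2"
      by (simp_all add: n_def path_length_def last_conv_nth)
    have "dot ?e1 ?e1 = (1 :: elem_real)" by simp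
    then obtain v where v: "point v = point ?e2" "C n \<le> dot ?e1 v"
      using path_dot_ge [OF _ p n(1)] \<open>n < k\<close> n(2) by auto
    then have "dot ?e1 v = 0 \<longleftrightarrow> dot ?e1 ?e2 = 0"
      by (intro dot_eq_0_parallel_cong parallel_refl) (simp flip: point_eq_iff)
    moreover have "dot ?e1 ?e2 = (0 :: elem_real)"
      by (simp only: dot_axis) (simp add: axis_def)
    ultimately show False
      using v(2) C_pos [OF \<open>n < k\<close>] by simp
  qed
qed (rule path_of_length_le)

end

section \<open>The case k = 2: the orthogonality graph\<close>

text \<open>Adjacency for the constant 0 is orthogonality itself, so automorphisms preserve it
  directly.\<close>

lemma orthogonality_graph_strongly_rotarily_transitive: "strongly_rotarily_transitive points (edges 0)"
proof (rule strongly_rotarily_transitive_points)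
  fix \<phi> and u v u' v' :: vec3
  assume \<phi>: "\<phi> \<in> carrier (aut_group points (edges 0))"
    and nz: "u \<noteq> 0" "v \<noteq> 0" "u' \<noteq> 0" "v' \<noteq> 0"
    and im: "point u' = \<phi> (point u)" "point v' = \<phi> (point v)"
  have "{\<phi> (point u), \<phi> (point v)} \<in> edges 0 \<longleftrightarrow> {point u, point v} \<in> edges 0"
    using \<phi> nz by (simp add: aut_group_iff)
  then show "dot u' v' = 0 \<longleftrightarrow> dot u v = 0"
    using nz by (simp add: edges_iff flip: im)
qed

lemma orthogonality_graph_path:
  assumes "x \<in> points" "y \<in> points"
  shows "\<exists>vs. path_connects points (edges 0) vs x y \<and> path_length vs \<le> 2"
proof -
  obtain u v :: vec3 where uv: "dot u u = 1" "dot v v = 1" "point u = x" "point v = y" "0 \<le> dot u v"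
    using points_pair_representatives [OF assms] .
  then show ?thesis
    using two_step_path [of u v 0] by simp
qed

lemma orthogonality_graph_diameter: "graph_diameter points (edges 0) = enat 2"
proof (rule graph_diameter_eqI)
  \<comment> \<open>These vectors are neither parallel nor orthogonal, which excludes paths of
    length 0 and 1.\<close>
  let ?u = "vector [1, 0, 0] :: vec3" and ?v = "vector [1, 1, 0] :: vec3"
  have nz: "?u \<noteq> 0" "?v \<noteq> 0"
    by (simp_all add: vec_eq_iff forall_3)
  then show "point ?u \<in> points" "point ?v \<in> points"
    by simp_all
  have "\<not> parallel ?u ?v"
    by (simp add: parallel_def vec_eq_iff forall_3)
  then have neq: "point ?u \<noteq> point ?v"
    by (simp add: point_eq_iff)
  have nadj: "{point ?u, point ?v} \<notin> edges 0"
    using nz by (simp add: edges_iff) (simp add: dot_def sum_3)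
  fix vs assume p: "path_connects points (edges 0) vs (point ?u) (point ?v)"
  show "2 \<le> path_length vs"
  proof (rule ccontr)
    assume "\<not> 2 \<le> path_length vs"
    have vs: "vs \<noteq> []" "hd vs = point ?u" "last vs = point ?v"
      and e: "\<And>i. Suc i < length vs \<Longrightarrow> {vs ! i, vs ! Suc i} \<in> edges 0"
      using p by (simp_all add: path_connects_def graph_path_def)
    have "length vs = Suc 0 \<or> length vs = Suc (Suc 0)"
      using \<open>\<not> 2 \<le> path_length vs\<close> \<open>vs \<noteq> []\<close>[folded length_0_conv]
      unfolding path_length_def by arith
    then consider a where "vs = [a]" | a b where "vs = [a, b]"
      unfolding length_Suc_conv by blast
    then show False
    proof cases
      case 1
      with vs neq show False by simp
    next
      case 2
      with vs e [of 0] nadj show False by simp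
    qed
  qed
qed (rule orthogonality_graph_path)

theorem theorem1p3:
  fixes k :: nat
  assumes "k \<ge> 2"
  shows "\<exists>(V :: nat set) (E :: nat set set).
           is_graph V E \<and> infinite V \<and> countable V \<and>
           graph_connected V E \<and>
           strongly_rotarily_transitive V E \<and>
           graph_diameter V E = enat k"
proof (cases "k = 2")
  case True
  have "is_graph points (edges 0)"
    by (rule is_graph_points) simp
  with True show ?thesis
    using infinite_points graph_connectedI [OF orthogonality_graph_path]
      orthogonality_graph_strongly_rotarily_transitive orthogonality_graph_diameter
    by (intro exI [of _ points] exI [of _ "edges 0"]) simp
next
  case False
  then obtain C S where "angle_subdivision k C S"
    using angle_subdivision_exists [of k] assms by auto
  then interpret angle_subdivision k C S .
  show ?thesis
    using is_graph_points [OF C_1_square(1)] infinite_points graph_connectedI [OF path_of_length_le]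
      strongly_rotarily_transitive_C_1 graph_diameter_C_1
    by (intro exI [of _ points] exI [of _ "edges (C 1)"]) simp
qed

end
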